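(* Let $T:M\to M$, $(V,\|\cdot\|)$, $\nu_0$, $E$, $(A_\varepsilon)_{\varepsilon\in E}$, $P_0$, $(P_\varepsilon)_{\varepsilon\in E}$ form a REPFO setting, with $\varphi_0$, $\mu_0$, $Q_\varepsilon$, $\eta_\varepsilon$, $\kappa_N$, $q_{k,\varepsilon}$ as defined in the context. Suppose that $\mu_0(A_\varepsilon)>0$ for all $\varepsilon\in E\setminus\{0\}$, that the limits $q_k:=\lim_{\varepsilon\to0}q_{k,\varepsilon}$ exist for all $k\ge0$, and that $$\theta:=1-\sum_{k=0}^\infty q_k$$ is strictly positive. For $\varepsilon\in E\setminus\{0\}$ let $$\delta_\varepsilon:=\min_{N\ge1}\,(N\eta_\varepsilon+\kappa_N).$$ Then $\delta_\varepsilon=\mathcal{O}(|\eta_\varepsilon\log\eta_\varepsilon|)$ as $\varepsilon\to0$, and there is a constant $C>0$ such that for all $\varepsilon\in E\setminus\{0\}$ sufficiently close to $0$ there exists $\xi_\varepsilon>0$ with the following property: for the first hitting time $\tau_\varepsilon(x)=\inf\{i\ge0:T^ix\in A_\varepsilon\}$ and all $t>0$, $$\left|\mu_0\left\{\tau_\varepsilon\ge\frac{t}{\xi_\varepsilon\,\mu_0(A_\varepsilon)}\right\}-e^{-t}\right|\le C\,\delta_\varepsilon\,\max(t,1)\,e^{-t}.$$ Moreover, these numbers $\xi_\varepsilon$ satisfy $\lim_{\varepsilon\to0}\xi_\varepsilon=\theta$.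
   Context: Notation. For $\varphi\in V$ and a bounded linear functional $\nu$ on $V$, $\varphi\otimes\nu$ is the operator $f\mapsto\nu(f)\varphi$. For an operator $R$ on $V$, $\nu R$ denotes the functional $\nu\circ R$; $\|\nu R\|$ is its dual norm, and $\|R\|$ is the operator norm. REPFO setting (rare event Perron-Frobenius operators). $E$ is a topological space of parameters containing a distinguished point $0$. $(V,\|\cdot\|)$ is a complex Banach space of functions or distributions on a metric space $M$ that contains the constant functions. $T:M\to M$ is a (measurable) map, $\nu_0$ is a reference probability measure on $M$, which also acts as a bounded linear functional on $V$ (for functions, $\nu_0(f)=\int f\,d\nu_0$). $P_0:V\to V$ is the Perron-Frobenius operator of $T$ with respect to $\nu_0$, i.e. $\nu_0\big((P_0f)\cdot g\big)=\nu_0\big(f\cdot (g\circ T)\big)$ for $f\in V$ and bounded measurable $g$ (for which the products make sense); in particular $\nu_0P_0=\nu_0$. $P_0$ is mixing in the following sense: (Mix) $P_0=\varphi_0\otimes\nu_0+Q_0$ with $\varphi_0\in V$, $P_0\varphi_0=\varphi_0$, $\nu_0P_0=\nu_0$, $Q_0\varphi_0=0$, $\nu_0Q_0=0$ (hence $\nu_0(\varphi_0)=1$), and $Q_0$ has spectral radius strictly smaller than $1$. $(A_\varepsilon)_{\varepsilon\in E}$ is a family of subsets of $M$, and for $\varepsilon\in E\setminus\{0\}$ the operator $P_\varepsilon$ is $P_\varepsilon f=P_0(1_{M\setminus A_\varepsilon}f)$ (at the parameter $\varepsilon=0$ the operator is $P_0$ itself, i.e. $A_0$ is empty or negligible). The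 following are assumed: (i) There are constants $\alpha\in(0,1)$, $D>0$ and a second norm (or only a seminorm) $|\cdot|_w\le\|\cdot\|$ on $V$ such that - for each $\varepsilon\in E$ the residual spectrum of $P_\varepsilon$ is contained in $\{z\in\mathbb{C}:|z|\le\alpha\}$; - $|P_\varepsilon^nf|_w\le D|f|_w$ for all $\varepsilon\in E$, $f\in V$, $n\in\mathbb{N}$; - $\|P_\varepsilon^nf\|\le D\alpha^n\|f\|+D|f|_w$ for all $\varepsilon\in E$, $f\in V$, $n\in\mathbb{N}$; - there is an upper semi-continuous function $\pi:E\to[0,\infty)$, $\varepsilon\mapsto\pi_\varepsilon$ (monotone in case $E\subseteq[0,\infty)$), with $\lim_{\varepsilon\to0}\pi_\varepsilon=0$ and $|P_\varepsilon f-P_0f|_w\le\pi_\varepsilon\|f\|$ for all $f\in V$, $\varepsilon\in E$. (ii) $1_{A_\varepsilon}\cdot f\in V$ for all $f\in V$ and $\varepsilon\in E$. (iii) There is a constant $K_0$ such that $|\nu_0(1_{A_\varepsilon}f)|\cdot\|1_{A_\varepsilon}\varphi_0\|\le K_0\,\|f\|\cdot|\nu_0(1_{A_\varepsilon}\varphi_0)|$ for all $f\in V$, $\varepsilon\in E$. Derived objects. $\mu_0$ is the $T$-invariant probability measure $\mu_0(A)=\int_A\varphi_0\,d\nu_0$. In a REPFO setting, after replacing $E$ by a suitable neighbourhood of $0$ (which is understood to have been done), there are $\lambda_\varepsilon\in\mathbb{C}\setminus\{0\}$ (with $\lambda_0=1$), $\varphi_\varepsilon\in V$, bounded linear functionals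 $\nu_\varepsilon$ on $V$ and linear operators $Q_\varepsilon:V\to V$ such that, for all $\varepsilon\in E$, $\lambda_\varepsilon^{-1}P_\varepsilon=\varphi_\varepsilon\otimes\nu_\varepsilon+Q_\varepsilon$, $P_\varepsilon\varphi_\varepsilon=\lambda_\varepsilon\varphi_\varepsilon$, $\nu_\varepsilon P_\varepsilon=\lambda_\varepsilon\nu_\varepsilon$, $Q_\varepsilon\varphi_\varepsilon=0$, $\nu_\varepsilon Q_\varepsilon=0$, $\nu_0(\varphi_\varepsilon)=1$, $\sup_{\varepsilon\in E}\|\varphi_\varepsilon\|<\infty$ and $\sum_{n\ge0}\sup_{\varepsilon\in E}\|Q_\varepsilon^n\|<\infty$. Put $$\eta_\varepsilon:=\|\nu_0(P_0-P_\varepsilon)\|=\sup\{|\nu_0(1_{A_\varepsilon}f)|:f\in V,\ \|f\|\le1\},\qquad \kappa_N:=\sum_{k=N}^\infty\sup_{\varepsilon\in E}\|Q_\varepsilon^k\|,$$ and, for $k\ge0$ and $\varepsilon$ with $\mu_0(A_\varepsilon)>0$, $$q_{k,\varepsilon}:=\frac{\mu_0\big(A_\varepsilon\cap T^{-1}A_\varepsilon^c\cap\dots\cap T^{-k}A_\varepsilon^c\cap T^{-(k+1)}A_\varepsilon\big)}{\mu_0(A_\varepsilon)},$$ where $A_\varepsilon^c=M\setminus A_\varepsilon$ (for $k=0$ the numerator is $\mu_0(A_\varepsilon\cap T^{-1}A_\varepsilon)$). *)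

theory Defs
  imports "HOL-Probability.Probability" "HOL-Library.Landau_Symbols"
begin

class scaleC =
  fixes scaleC :: "complex \<Rightarrow> 'a \<Rightarrow> 'a" (infixr "*\<^sub>C" 75)

class complex_banach = banach + scaleC +
  assumes scaleC_add_right: "a *\<^sub>C (x + y) = a *\<^sub>C x + a *\<^sub>C y"
    and scaleC_add_left: "(a + b) *\<^sub>C x = a *\<^sub>C x + b *\<^sub>C x"
    and scaleC_scaleC: "a *\<^sub>C (b *\<^sub>C x) = (a * b) *\<^sub>C x"
    and scaleC_one: "1 *\<^sub>C x = x"
    and scaleR_scaleC: "r *\<^sub>R x = complex_of_real r *\<^sub>C x"
    and norm_scaleC: "norm (a *\<^sub>C x) = cmod a * norm x"

instantiation complex :: complex_banach
begin

definition scaleC_complex :: "complex \<Rightarrow> complex \<Rightarrow> complex" where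
  "scaleC_complex a x = a * x"

instance
  by standard (auto simp: scaleC_complex_def algebra_simps norm_mult scaleR_conv_of_real)

end

definition bounded_clinear :: "('a::complex_banach \<Rightarrow> 'b::complex_banach) \<Rightarrow> bool" where
  "bounded_clinear f \<longleftrightarrow> bounded_linear f \<and> (\<forall>c x. f (c *\<^sub>C x) = c *\<^sub>C f x)"

definition spectrum :: "('a::complex_banach \<Rightarrow> 'a) \<Rightarrow> complex set" where
  "spectrum R = {z. \<not> (\<exists>S. bounded_clinear S \<and>
     (\<forall>x. S (z *\<^sub>C x - R x) = x) \<and> (\<forall>x. z *\<^sub>C S x - R (S x) = x))}"

text \<open>The supremum is meaningful for bounded operators on a nonzero space, whose spectrum is
  compact and nonempty.\<close>

definition spectral_radius :: "('a::complex_banach \<Rightarrow> 'a) \<Rightarrow> real" where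
  "spectral_radius R = (SUP z\<in>spectrum R. cmod z)"

definition residual_spectrum :: "('a::complex_banach \<Rightarrow> 'a) \<Rightarrow> complex set" where
  "residual_spectrum R =
     {z. inj (\<lambda>x. z *\<^sub>C x - R x) \<and> closure (range (\<lambda>x. z *\<^sub>C x - R x)) \<noteq> UNIV}"

definition rank_one :: "'a::complex_banach \<Rightarrow> ('a \<Rightarrow> complex) \<Rightarrow> 'a \<Rightarrow> 'a" (infixr "\<otimes>\<^sub>r" 70) where
  "(\<phi> \<otimes>\<^sub>r \<nu>) f = \<nu> f *\<^sub>C \<phi>"

definition seminorm :: "('a::complex_banach \<Rightarrow> real) \<Rightarrow> bool" where
  "seminorm w \<longleftrightarrow> (\<forall>f. 0 \<le> w f) \<and> (\<forall>f h. w (f + h) \<le> w f + w h) \<and>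
     (\<forall>c f. w (c *\<^sub>C f) = cmod c * w f)"

definition upper_semicontinuous :: "('e::topological_space \<Rightarrow> real) \<Rightarrow> bool" where
  "upper_semicontinuous f \<longleftrightarrow> (\<forall>c. open {x. f x < c})"

text \<open>A distribution \<open>f\<close> is a linear functional on a class \<open>\<T>\<close> of bounded Borel test functions, and
  its value at \<open>g\<close> plays the role of \<open>\<nu>\<^sub>0(f \<cdot> g)\<close>.  The class \<open>\<T>\<close> thus consists of bounded
  measurable \<open>g\<close> for which the products with elements of the space make sense.
  Functions modulo \<open>\<nu>\<^sub>0\<close>-null sets are the distributions \<open>g \<mapsto> \<integral> f g d\<nu>\<^sub>0\<close>, while
  everywhere defined functions are covered by the constructor \<open>Function\<close>.\<close>

datatype 'm gfun =
    Function "'m \<Rightarrow> complex"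
  | Distribution "('m \<Rightarrow> complex) \<Rightarrow> complex"

primrec pairing :: "'m measure \<Rightarrow> 'm gfun \<Rightarrow> ('m \<Rightarrow> complex) \<Rightarrow> complex" where
  "pairing N (Function f) g = (\<integral>x. f x * g x \<partial>N)"
| "pairing N (Distribution u) g = u g"

primrec gmult :: "('m \<Rightarrow> complex) set \<Rightarrow> ('m \<Rightarrow> complex) \<Rightarrow> 'm gfun \<Rightarrow> 'm gfun" where
  "gmult \<T> g (Function f) = Function (\<lambda>x. g x * f x)"
| "gmult \<T> g (Distribution u) = Distribution (\<lambda>h\<in>\<T>. u (\<lambda>x. g x * h x))"

definition test_functions ::
  "('m::metric_space \<Rightarrow> 'm) \<Rightarrow> ('e \<Rightarrow> 'm set) \<Rightarrow> ('m \<Rightarrow> complex) set \<Rightarrow> bool" where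
  "test_functions T A \<T> \<longleftrightarrow>
     (\<forall>g\<in>\<T>. g \<in> borel_measurable borel \<and> bounded (range g)) \<and>
     (\<lambda>_. 1) \<in> \<T> \<and>
     (\<forall>g\<in>\<T>. \<forall>h\<in>\<T>. (\<lambda>x. g x + h x) \<in> \<T>) \<and>
     (\<forall>c. \<forall>g\<in>\<T>. (\<lambda>x. c * g x) \<in> \<T>) \<and>
     (\<forall>\<epsilon>. \<forall>g\<in>\<T>. (\<lambda>x. indicator (A \<epsilon>) x * g x) \<in> \<T>) \<and>
     (\<forall>g\<in>\<T>. g \<circ> T \<in> \<T>)"

definition function_space ::
  "'m measure \<Rightarrow> ('v::complex_banach \<Rightarrow> 'm \<Rightarrow> complex) \<Rightarrow> bool" where
  "function_space N F \<longleftrightarrow>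
     inj F \<and>
     (\<forall>f h x. F (f + h) x = F f x + F h x) \<and>
     (\<forall>c f x. F (c *\<^sub>C f) x = c * F f x) \<and>
     (\<forall>f. integrable N (F f)) \<and>
     (\<forall>c. \<exists>f. F f = (\<lambda>_. c))"

definition distribution_space ::
  "'m measure \<Rightarrow> ('m \<Rightarrow> complex) set \<Rightarrow> ('v::complex_banach \<Rightarrow> ('m \<Rightarrow> complex) \<Rightarrow> complex) \<Rightarrow> bool"
where
  "distribution_space N \<T> U \<longleftrightarrow>
     inj U \<and>
     (\<forall>f. U f \<in> extensional \<T>) \<and>
     (\<forall>f h. \<forall>g\<in>\<T>. U (f + h) g = U f g + U h g) \<and>
     (\<forall>c f. \<forall>g\<in>\<T>. U (c *\<^sub>C f) g = c * U f g) \<and>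
     (\<forall>f. \<forall>g\<in>\<T>. \<forall>h\<in>\<T>. U f (\<lambda>x. g x + h x) = U f g + U f h) \<and>
     (\<forall>c f. \<forall>g\<in>\<T>. U f (\<lambda>x. c * g x) = c * U f g) \<and>
     (\<forall>c. \<exists>f. \<forall>g\<in>\<T>. U f g = c * (\<integral>x. g x \<partial>N))"

text \<open>The Banach space \<open>V\<close> is a type \<open>'v\<close> whose elements are identified, through the injection
  \<open>rep\<close>, with functions or with distributions on \<open>M\<close>.\<close>

definition gfun_space ::
  "'m measure \<Rightarrow> ('m \<Rightarrow> complex) set \<Rightarrow> ('v::complex_banach \<Rightarrow> 'm gfun) \<Rightarrow> bool" where
  "gfun_space N \<T> rep \<longleftrightarrow>
     (\<exists>F. rep = (\<lambda>f. Function (F f)) \<and> function_space N F) \<or>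
     (\<exists>U. rep = (\<lambda>f. Distribution (U f)) \<and> distribution_space N \<T> U)"

definition ref_functional :: "'m measure \<Rightarrow> ('v \<Rightarrow> 'm gfun) \<Rightarrow> 'v \<Rightarrow> complex" where
  "ref_functional N rep f = pairing N (rep f) (\<lambda>_. 1)"

text \<open>The product \<open>1\<^sub>B \<cdot> f\<close> as an element of \<open>V\<close>, provided that it belongs to \<open>V\<close>.\<close>

definition ind_mult ::
  "('m \<Rightarrow> complex) set \<Rightarrow> ('v \<Rightarrow> 'm gfun) \<Rightarrow> 'm set \<Rightarrow> 'v \<Rightarrow> 'v" where
  "ind_mult \<T> rep B f = inv rep (gmult \<T> (indicator B) (rep f))"

text \<open>The parameter space \<open>E\<close> is the type \<open>'e\<close>, with distinguished point \<open>e0\<close>, and \<open>P e0\<close> is the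
  unperturbed operator.  If \<open>E\<close> is a subset of the half-line, \<open>\<pi>\<close> is usually required to be
  monotone as well; nothing depends on this and it is not assumed.\<close>

definition uniform_lasota_yorke ::
  "('e::topological_space \<Rightarrow> 'v::complex_banach \<Rightarrow> 'v) \<Rightarrow> 'e \<Rightarrow> bool" where
  "uniform_lasota_yorke P e0 \<longleftrightarrow>
     (\<exists>\<alpha> D w \<pi>. 0 < \<alpha> \<and> \<alpha> < 1 \<and> 0 < D \<and>
        seminorm w \<and> (\<forall>f. w f \<le> norm f) \<and>
        (\<forall>\<epsilon>. residual_spectrum (P \<epsilon>) \<subseteq> {z. cmod z \<le> \<alpha>}) \<and>
        (\<forall>\<epsilon> f n. w ((P \<epsilon> ^^ n) f) \<le> D * w f) \<and>
        (\<forall>\<epsilon> f n. norm ((P \<epsilon> ^^ n) f) \<le> D * \<alpha> ^ n * norm f + D * w f) \<and>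
        (\<forall>\<epsilon>. 0 \<le> \<pi> \<epsilon>) \<and> upper_semicontinuous \<pi> \<and> (\<pi> \<longlongrightarrow> 0) (at e0) \<and>
        (\<forall>\<epsilon> f. w (P \<epsilon> f - P e0 f) \<le> \<pi> \<epsilon> * norm f))"

text \<open>The condition \<open>A0_negligible\<close> holds in particular if \<open>A e0\<close> is empty and, for functions, if it
  is a null set of the reference measure.\<close>

locale repfo =
  fixes T :: "'m::metric_space \<Rightarrow> 'm"
    and N0 :: "'m measure"
    and \<T> :: "('m \<Rightarrow> complex) set"
    and rep :: "'v::complex_banach \<Rightarrow> 'm gfun"
    and e0 :: "'e::topological_space"
    and A :: "'e \<Rightarrow> 'm set"
    and P :: "'e \<Rightarrow> 'v \<Rightarrow> 'v"
    and \<phi>0 :: 'v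
    and Q0 :: "'v \<Rightarrow> 'v"
  assumes T_measurable: "T \<in> borel_measurable borel"
    and N0_sets: "sets N0 = sets borel"
    and N0_prob: "prob_space N0"
    and A_sets: "\<And>\<epsilon>. A \<epsilon> \<in> sets borel"
    and test: "test_functions T A \<T>"
    and V_space: "gfun_space N0 \<T> rep"
    and ref_bounded: "bounded_clinear (ref_functional N0 rep)"
    and P0_bounded: "bounded_clinear (P e0)"
    and P0_dual: "\<And>f g. g \<in> \<T> \<Longrightarrow> pairing N0 (rep (P e0 f)) g = pairing N0 (rep f) (g \<circ> T)"
    and mix_decomp: "\<And>f. P e0 f = (\<phi>0 \<otimes>\<^sub>r ref_functional N0 rep) f + Q0 f"
    and mix_right: "P e0 \<phi>0 = \<phi>0"
    and mix_left: "\<And>f. ref_functional N0 rep (P e0 f) = ref_functional N0 rep f"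
    and Q0_bounded: "bounded_clinear Q0"
    and Q0_right: "Q0 \<phi>0 = 0"
    and Q0_left: "\<And>f. ref_functional N0 rep (Q0 f) = 0"
    and Q0_radius: "spectral_radius Q0 < 1"
    and P_def: "\<And>\<epsilon> f. \<epsilon> \<noteq> e0 \<Longrightarrow> P \<epsilon> f = P e0 (ind_mult \<T> rep (- A \<epsilon>) f)"
    and A0_negligible: "\<And>f. ref_functional N0 rep (ind_mult \<T> rep (A e0) f) = 0"
    and lasota_yorke: "uniform_lasota_yorke P e0"
    and ind_mult_closed: "\<And>\<epsilon> f. gmult \<T> (indicator (A \<epsilon>)) (rep f) \<in> range rep"
    and ind_mult_bound: "\<exists>K0. \<forall>\<epsilon> f.
      cmod (ref_functional N0 rep (ind_mult \<T> rep (A \<epsilon>) f)) * norm (ind_mult \<T> rep (A \<epsilon>) \<phi>0)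
        \<le> K0 * norm f * cmod (ref_functional N0 rep (ind_mult \<T> rep (A \<epsilon>) \<phi>0))"

text \<open>The spectral decompositions furnished by perturbation theory once the parameter space has been
  replaced by a suitable neighbourhood of the distinguished point.\<close>

locale repfo_spectral =
  fixes \<nu>0 :: "'v::complex_banach \<Rightarrow> complex"
    and e0 :: "'e::topological_space"
    and P :: "'e \<Rightarrow> 'v \<Rightarrow> 'v"
    and lam :: "'e \<Rightarrow> complex"
    and \<phi> :: "'e \<Rightarrow> 'v"
    and \<nu> :: "'e \<Rightarrow> 'v \<Rightarrow> complex"
    and Q :: "'e \<Rightarrow> 'v \<Rightarrow> 'v"
  assumes lam_nonzero: "\<And>\<epsilon>. lam \<epsilon> \<noteq> 0"
    and lam_e0: "lam e0 = 1"
    and \<nu>_e0: "\<nu> e0 = \<nu>0"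
    and \<nu>_bounded: "\<And>\<epsilon>. bounded_clinear (\<nu> \<epsilon>)"
    and Q_bounded: "\<And>\<epsilon>. bounded_clinear (Q \<epsilon>)"
    and decomp: "\<And>\<epsilon> f. inverse (lam \<epsilon>) *\<^sub>C P \<epsilon> f = (\<phi> \<epsilon> \<otimes>\<^sub>r \<nu> \<epsilon>) f + Q \<epsilon> f"
    and right_eigen: "\<And>\<epsilon>. P \<epsilon> (\<phi> \<epsilon>) = lam \<epsilon> *\<^sub>C \<phi> \<epsilon>"
    and left_eigen: "\<And>\<epsilon> f. \<nu> \<epsilon> (P \<epsilon> f) = lam \<epsilon> * \<nu> \<epsilon> f"
    and Q_right: "\<And>\<epsilon>. Q \<epsilon> (\<phi> \<epsilon>) = 0"
    and Q_left: "\<And>\<epsilon> f. \<nu> \<epsilon> (Q \<epsilon> f) = 0"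
    and \<phi>_normalized: "\<And>\<epsilon>. \<nu>0 (\<phi> \<epsilon>) = 1"
    and \<phi>_uniform: "bdd_above (range (\<lambda>\<epsilon>. norm (\<phi> \<epsilon>)))"
    and Q_uniform: "\<And>n. bdd_above (range (\<lambda>\<epsilon>. onorm (Q \<epsilon> ^^ n)))"
    and Q_summable: "summable (\<lambda>n. SUP \<epsilon>. onorm (Q \<epsilon> ^^ n))"

text \<open>For distributions \<open>\<integral>\<^sub>B \<phi>0 d\<nu>\<^sub>0\<close> makes sense only if the indicator of \<open>B\<close> is a test function;
  if \<open>\<T>\<close> consists of all bounded Borel functions, every Borel set \<open>B\<close> qualifies.\<close>

definition invariant_measure_of ::
  "('m::metric_space \<Rightarrow> 'm) \<Rightarrow> 'm measure \<Rightarrow> ('m \<Rightarrow> complex) set \<Rightarrow> 'm gfun \<Rightarrow> 'm measure \<Rightarrow> bool" where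
  "invariant_measure_of T N0 \<T> \<phi>0 \<mu>0 \<longleftrightarrow>
     prob_space \<mu>0 \<and> sets \<mu>0 = sets borel \<and> distr \<mu>0 borel T = \<mu>0 \<and>
     (\<forall>B\<in>sets borel. indicator B \<in> \<T> \<longrightarrow>
        pairing N0 \<phi>0 (indicator B) = complex_of_real (measure \<mu>0 B))"

definition eta :: "('v::complex_banach \<Rightarrow> complex) \<Rightarrow> 'e \<Rightarrow> ('e \<Rightarrow> 'v \<Rightarrow> 'v) \<Rightarrow> 'e \<Rightarrow> real" where
  "eta \<nu>0 e0 P \<epsilon> = onorm (\<lambda>f. \<nu>0 (P e0 f - P \<epsilon> f))"

definition kappa :: "('e \<Rightarrow> 'v::complex_banach \<Rightarrow> 'v) \<Rightarrow> nat \<Rightarrow> real" where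
  "kappa Q N = (\<Sum>k. SUP \<epsilon>. onorm (Q \<epsilon> ^^ (k + N)))"

text \<open>The infimum is attained whenever \<open>eta \<nu>0 e0 P \<epsilon> > 0\<close>.\<close>

definition delta ::
  "('v::complex_banach \<Rightarrow> complex) \<Rightarrow> 'e \<Rightarrow> ('e \<Rightarrow> 'v \<Rightarrow> 'v) \<Rightarrow> ('e \<Rightarrow> 'v \<Rightarrow> 'v) \<Rightarrow> 'e \<Rightarrow> real" where
  "delta \<nu>0 e0 P Q \<epsilon> = (INF N\<in>{1..}. real N * eta \<nu>0 e0 P \<epsilon> + kappa Q N)"

definition return_ratio :: "'m measure \<Rightarrow> ('m \<Rightarrow> 'm) \<Rightarrow> 'm set \<Rightarrow> nat \<Rightarrow> real" where
  "return_ratio \<mu>0 T B k =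
     measure \<mu>0 {x \<in> B. (\<forall>i\<in>{1..k}. (T ^^ i) x \<notin> B) \<and> (T ^^ (k + 1)) x \<in> B} / measure \<mu>0 B"

definition hitting_time :: "('m \<Rightarrow> 'm) \<Rightarrow> 'm set \<Rightarrow> 'm \<Rightarrow> enat" where
  "hitting_time T B x = (INF i\<in>{i. (T ^^ i) x \<in> B}. enat i)"

end

theory Submission
  imports Defs
begin

text \<open>
  The set of points that avoid the hole \<open>A\<^sub>\<epsilon>\<close> up to time \<open>n - 1\<close> has measure
  \<open>\<nu>\<^sub>0 (P\<^sub>\<epsilon>\<^sup>n \<phi>\<^sub>0)\<close>, since every application of \<open>P\<^sub>\<epsilon>\<close> first removes the mass in the hole
  (lemma \<open>survival_measure\<close>).  The spectral decomposition turns this into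
  \<open>\<lambda>\<^sup>n (\<nu>\<^sub>\<epsilon> (\<phi>\<^sub>0) + \<nu>\<^sub>0 (Q\<^sub>\<epsilon>\<^sup>n \<phi>\<^sub>0))\<close> with \<open>\<lambda> = \<lambda>\<^sub>\<epsilon>\<close>.  Choosing
  \<open>\<xi>\<^sub>\<epsilon> = - ln \<lambda> / \<mu>\<^sub>0 (A\<^sub>\<epsilon>)\<close> makes \<open>\<lambda>\<^sup>n\<close> equal to \<open>e\<^sup>-\<^sup>t\<close>, up to the rounding of the time to
  an integer, which costs a factor between \<open>\<lambda>\<close> and \<open>1\<close>.  Three things remain.

  The errors \<open>1 - \<lambda>\<close>, \<open>\<nu>\<^sub>\<epsilon> (\<phi>\<^sub>0) - 1\<close> and \<open>\<nu>\<^sub>0 (Q\<^sub>\<epsilon>\<^sup>n \<phi>\<^sub>0)\<close> are all \<open>O(\<eta>\<^sub>\<epsilon>)\<close>, uniformly in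
  \<open>n \<ge> 1\<close>: one step of the normalised operator changes \<open>\<nu>\<^sub>0\<close> by \<open>O(\<eta>\<^sub>\<epsilon>)\<close>, and summing these
  changes along \<open>Q\<^sub>\<epsilon>\<^sup>j \<phi>\<^sub>0\<close> costs a constant only, because the norms of the powers are summable
  (lemma \<open>\<nu>0_remainder_bound\<close>).  As \<open>\<eta>\<^sub>\<epsilon> \<le> \<delta>\<^sub>\<epsilon>\<close>, this gives the bound on the hitting time
  (lemma \<open>hitting_time_bound\<close>).  The Lasota-Yorke inequality shows \<open>\<eta>\<^sub>\<epsilon> \<rightarrow> 0\<close> (lemma
  \<open>\<eta>_tendsto_0\<close>).

  The limit of \<open>\<xi>\<^sub>\<epsilon>\<close> is that of \<open>(1 - \<lambda>) / \<mu>\<^sub>0 (A\<^sub>\<epsilon>)\<close>.  Expanding \<open>P\<^sub>\<epsilon>\<^sup>n \<phi>\<^sub>0\<close> around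
  \<open>P\<^sub>0\<^sup>n \<phi>\<^sub>0 = \<phi>\<^sub>0\<close> in powers of \<open>P\<^sub>\<epsilon>\<close> produces exactly the measures of the sets of points that
  leave the hole and return to it for the first time after \<open>k + 1\<close> steps (lemmas
  \<open>eigenvalue_expansion\<close> and \<open>defect_P_pow_defect_\<phi>0\<close>).  Hence the quotient is
  \<open>1 - (\<Sum>k<n. q\<^sub>k\<^sub>,\<^sub>\<epsilon>)\<close> up to an error that, by the bound on \<open>1\<^sub>A \<phi>\<^sub>0\<close>, is \<open>O(\<kappa>\<^sub>n) + o(1)\<close>
  for fixed \<open>n\<close>; letting first \<open>\<epsilon> \<rightarrow> 0\<close> and then \<open>n \<rightarrow> \<infinity>\<close> gives \<open>\<theta>\<close> (lemma
  \<open>escape_ratio_lim\<close>).  That \<open>\<lambda>\<close> is a real number in the interval from \<open>0\<close> to \<open>1\<close>, so that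
  the logarithm makes sense, follows because it is a limit of ratios of probabilities and
  because \<open>\<theta> > 0\<close>.

  Finally \<open>\<delta>\<^sub>\<epsilon> = O(\<eta>\<^sub>\<epsilon> |ln \<eta>\<^sub>\<epsilon>|)\<close>, because the suprema of the norms are submultiplicative and
  so \<open>\<kappa>\<^sub>N\<close> decays geometrically (lemma \<open>delta_bigo\<close>).
\<close>

section \<open>Complex scalars and powers of bounded operators\<close>

lemmas bounded_linear_0 = linear_0 [OF bounded_linear.linear]
lemmas bounded_linear_plus = linear_add [OF bounded_linear.linear]
lemmas bounded_linear_diff = linear_diff [OF bounded_linear.linear]

lemma bounded_linear_scaleC_right: "bounded_linear (\<lambda>x :: 'a :: complex_banach. c *\<^sub>C x)"
  by (rule bounded_linear_intro[where K = "cmod c"])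
    (auto simp: scaleC_add_right scaleR_scaleC scaleC_scaleC norm_scaleC mult.commute)

lemma bounded_linear_scaleC_left: "bounded_linear (\<lambda>c. c *\<^sub>C (x :: 'a :: complex_banach))"
  by (rule bounded_linear_intro[where K = "norm x"])
    (auto simp: scaleC_add_left scaleR_scaleC scaleC_scaleC norm_scaleC scaleR_conv_of_real
      scaleC_complex_def)

lemmas scaleC_linear_simps [simp] =
  bounded_linear_0 [OF bounded_linear_scaleC_right]
  bounded_linear_0 [OF bounded_linear_scaleC_left]

lemmas scaleC_diff_right = bounded_linear_diff [OF bounded_linear_scaleC_right]
lemmas scaleC_diff_left = bounded_linear_diff [OF bounded_linear_scaleC_left]

lemma bounded_clinear_imp_bounded_linear: "bounded_clinear f \<Longrightarrow> bounded_linear f"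
  by (simp add: bounded_clinear_def)

lemma bounded_clinear_scaleC: "bounded_clinear f \<Longrightarrow> f (c *\<^sub>C x) = c *\<^sub>C f x"
  by (simp add: bounded_clinear_def)

lemma bounded_linear_funpow:
  assumes "bounded_linear (f :: 'a :: real_normed_vector \<Rightarrow> 'a)"
  shows "bounded_linear (f ^^ n)"
proof (induction n)
  case 0
  show ?case by (simp add: id_def bounded_linear_ident)
next
  case (Suc n)
  then show ?case
    using bounded_linear_compose[OF assms Suc] by (simp add: o_def)
qed

lemma norm_le_suminf_increments:
  fixes x :: "nat \<Rightarrow> 'a :: banach"
  assumes lim: "x \<longlonglongrightarrow> 0" and b: "summable b"
    and step: "\<And>j. j \<ge> n \<Longrightarrow> norm (x j - x (Suc j)) \<le> b j"
  shows "norm (x n) \<le> (\<Sum>j. b (j + n))"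
proof -
  have "(\<lambda>j. x (j + n)) \<longlonglongrightarrow> 0"
    using lim by (rule LIMSEQ_ignore_initial_segment)
  from telescope_sums'[OF this] have "(\<lambda>j. x (j + n) - x (Suc j + n)) sums x n"
    by simp
  then have "x n = (\<Sum>j. x (j + n) - x (Suc j + n))"
    by (rule sums_unique)
  also have "norm \<dots> \<le> (\<Sum>j. b (j + n))"
    by (rule norm_suminf_le) (use step b in \<open>auto simp: summable_iff_shift\<close>)
  finally show ?thesis .
qed

section \<open>Estimates from the spectral decomposition\<close>

context repfo_spectral
begin

abbreviation defect :: "'e \<Rightarrow> 'v \<Rightarrow> 'v" where
  "defect \<epsilon> f \<equiv> P e0 f - P \<epsilon> f"

abbreviation \<eta> :: "'e \<Rightarrow> real" where
  "\<eta> \<epsilon> \<equiv> eta \<nu>0 e0 P \<epsilon>"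

abbreviation Q_sup :: "nat \<Rightarrow> real" where
  "Q_sup n \<equiv> (SUP \<epsilon>. onorm (Q \<epsilon> ^^ n))"

lemma \<nu>0_bounded: "bounded_clinear \<nu>0"
  using \<nu>_bounded[of e0] by (simp add: \<nu>_e0)

lemma \<nu>_scaleC: "\<nu> \<epsilon> (c *\<^sub>C f) = c * \<nu> \<epsilon> f"
  using bounded_clinear_scaleC[OF \<nu>_bounded] by (simp add: scaleC_complex_def)

lemma \<nu>0_scaleC: "\<nu>0 (c *\<^sub>C f) = c * \<nu>0 f"
  using \<nu>_scaleC[of e0] by (simp add: \<nu>_e0)

lemmas \<nu>_linear = bounded_clinear_imp_bounded_linear [OF \<nu>_bounded]
lemmas \<nu>0_linear = bounded_clinear_imp_bounded_linear [OF \<nu>0_bounded]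
lemmas Q_linear = bounded_clinear_imp_bounded_linear [OF Q_bounded]
lemmas Q_pow_linear = bounded_linear_funpow [OF Q_linear]

lemma P_decomp: "P \<epsilon> f = lam \<epsilon> *\<^sub>C (\<nu> \<epsilon> f *\<^sub>C \<phi> \<epsilon> + Q \<epsilon> f)"
  using arg_cong[OF decomp[of \<epsilon> f], of "scaleC (lam \<epsilon>)"] lam_nonzero[of \<epsilon>]
  by (simp add: scaleC_scaleC scaleC_one rank_one_def)

lemma P_linear: "bounded_linear (P \<epsilon>)"
proof -
  have "bounded_linear (\<lambda>f. lam \<epsilon> *\<^sub>C (\<nu> \<epsilon> f *\<^sub>C \<phi> \<epsilon> + Q \<epsilon> f))"
    by (intro bounded_linear_compose[OF bounded_linear_scaleC_right] bounded_linear_add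
        bounded_linear_compose[OF bounded_linear_scaleC_left] \<nu>_linear Q_linear)
  then show ?thesis
    by (simp add: P_decomp[abs_def])
qed

lemmas P_pow_linear = bounded_linear_funpow [OF P_linear]

lemma P_scaleC: "P \<epsilon> (c *\<^sub>C f) = c *\<^sub>C P \<epsilon> f"
  by (simp add: P_decomp \<nu>_scaleC bounded_clinear_scaleC[OF Q_bounded] scaleC_add_right
      scaleC_scaleC mult_ac)

lemma \<nu>0_P0: "\<nu>0 (P e0 f) = \<nu>0 f"
  using left_eigen[of e0 f] by (simp add: \<nu>_e0 lam_e0)

lemma P0_\<phi>0: "P e0 (\<phi> e0) = \<phi> e0"
  using right_eigen[of e0] by (simp add: lam_e0 scaleC_one)

lemma \<phi>_nonzero: "\<phi> \<epsilon> \<noteq> 0"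
  using \<phi>_normalized[of \<epsilon>] bounded_linear_0[OF \<nu>0_linear] by auto

lemma \<nu>_Q_pow: "\<nu> \<epsilon> ((Q \<epsilon> ^^ Suc n) f) = 0"
  by (simp add: Q_left)

lemma Q_pow_\<phi>: "(Q \<epsilon> ^^ Suc n) (\<phi> \<epsilon>) = 0"
  unfolding funpow_Suc_right
  by (simp add: Q_right bounded_linear_0[OF Q_pow_linear])

lemma P_pow_decomp:
  "(P \<epsilon> ^^ Suc n) f = lam \<epsilon> ^ Suc n *\<^sub>C (\<nu> \<epsilon> f *\<^sub>C \<phi> \<epsilon> + (Q \<epsilon> ^^ Suc n) f)"
proof (induction n)
  case 0
  show ?case by (simp add: P_decomp)
next
  case (Suc n)
  have PQ: "P \<epsilon> ((Q \<epsilon> ^^ Suc n) f) = lam \<epsilon> *\<^sub>C (Q \<epsilon> ^^ Suc (Suc n)) f"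
    using P_decomp[of \<epsilon> "(Q \<epsilon> ^^ Suc n) f"] \<nu>_Q_pow[of \<epsilon> n f] by simp
  have "(P \<epsilon> ^^ Suc (Suc n)) f = P \<epsilon> ((P \<epsilon> ^^ Suc n) f)"
    by simp
  also have "\<dots> = lam \<epsilon> ^ Suc n *\<^sub>C (\<nu> \<epsilon> f *\<^sub>C P \<epsilon> (\<phi> \<epsilon>) + P \<epsilon> ((Q \<epsilon> ^^ Suc n) f))"
    unfolding Suc P_scaleC bounded_linear_plus[OF P_linear] ..
  also have "\<dots> = lam \<epsilon> ^ Suc (Suc n) *\<^sub>C (\<nu> \<epsilon> f *\<^sub>C \<phi> \<epsilon> + (Q \<epsilon> ^^ Suc (Suc n)) f)"
    unfolding PQ right_eigen by (simp add: scaleC_add_right scaleC_scaleC mult_ac)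
  finally show ?case .
qed

subsection \<open>The hole as a small perturbation seen by the reference functional\<close>

lemma defect_functional_linear: "bounded_linear (\<lambda>f. \<nu>0 (defect \<epsilon> f))"
  by (intro bounded_linear_compose[OF \<nu>0_linear] bounded_linear_sub P_linear)

lemma defect_functional_scaleC: "\<nu>0 (defect \<epsilon> (c *\<^sub>C f)) = c * \<nu>0 (defect \<epsilon> f)"
  by (simp add: P_scaleC scaleC_diff_right[symmetric] \<nu>0_scaleC)

lemma defect_functional_le: "cmod (\<nu>0 (defect \<epsilon> f)) \<le> \<eta> \<epsilon> * norm f"
  unfolding eta_def by (rule onorm[OF defect_functional_linear])

lemma \<eta>_nonneg: "0 \<le> \<eta> \<epsilon>"
  unfolding eta_def by (rule onorm_pos_le[OF defect_functional_linear])

lemma one_minus_lam: "1 - lam \<epsilon> = \<nu>0 (defect \<epsilon> (\<phi> \<epsilon>))"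
  by (simp add: bounded_linear_diff[OF \<nu>0_linear] \<nu>0_P0 \<phi>_normalized right_eigen \<nu>0_scaleC)

lemma one_minus_lam_bound: "\<exists>B\<ge>0. \<forall>\<epsilon>. cmod (1 - lam \<epsilon>) \<le> B * \<eta> \<epsilon>"
proof -
  obtain B where B: "norm (\<phi> \<epsilon>) \<le> B" for \<epsilon>
    using \<phi>_uniform by (auto simp: bdd_above_def)
  have "0 \<le> B"
    using B[of e0] norm_ge_zero order_trans by blast
  moreover have "cmod (1 - lam \<epsilon>) \<le> B * \<eta> \<epsilon>" for \<epsilon>
    using defect_functional_le[where \<epsilon> = \<epsilon> and f = "\<phi> \<epsilon>"] mult_left_mono[OF B[of \<epsilon>] \<eta>_nonneg[of \<epsilon>]]
    by (simp add: one_minus_lam mult.commute)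
  ultimately show ?thesis by blast
qed

subsection \<open>Powers of the remainder\<close>

lemma onorm_Q_pow_nonneg: "0 \<le> onorm (Q \<epsilon> ^^ n)"
  by (rule onorm_pos_le[OF Q_pow_linear])

lemma onorm_Q_pow_le: "onorm (Q \<epsilon> ^^ n) \<le> Q_sup n"
  by (rule cSUP_upper[OF UNIV_I Q_uniform])

lemma Q_sup_nonneg: "0 \<le> Q_sup n"
  using onorm_Q_pow_nonneg onorm_Q_pow_le order_trans by blast

lemma norm_Q_pow_le: "norm ((Q \<epsilon> ^^ n) f) \<le> Q_sup n * norm f"
  using onorm[OF Q_pow_linear[where \<epsilon> = \<epsilon> and n = n], of f] mult_right_mono[OF onorm_Q_pow_le norm_ge_zero]
  by (rule order_trans)

lemma Q_pow_tendsto_0: "(\<lambda>n. (Q \<epsilon> ^^ n) f) \<longlonglongrightarrow> 0"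
proof (rule Lim_null_comparison[OF always_eventually])
  show "\<forall>n. norm ((Q \<epsilon> ^^ n) f) \<le> Q_sup n * norm f"
    by (simp add: norm_Q_pow_le)
  show "(\<lambda>n. Q_sup n * norm f) \<longlonglongrightarrow> 0"
    using tendsto_mult_right[OF summable_LIMSEQ_zero[OF Q_summable], of "norm f"] by simp
qed

lemma Q_sup_summable: "summable (\<lambda>k. Q_sup (k + N))"
  using Q_summable by (subst summable_iff_shift)

lemma kappa_eq: "kappa Q N = (\<Sum>k. Q_sup (k + N))"
  by (simp add: kappa_def)

lemma kappa_nonneg: "0 \<le> kappa Q N"
  unfolding kappa_eq
  by (intro suminf_nonneg Q_sup_summable Q_sup_nonneg)

lemma kappa_tendsto_0: "kappa Q \<longlonglongrightarrow> 0"
  unfolding kappa_eq[abs_def] by (rule suminf_exist_split2[OF Q_summable])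

lemma diff_normalized_P:
  "f - inverse (lam \<epsilon>) *\<^sub>C P \<epsilon> f = f - \<nu> \<epsilon> f *\<^sub>C \<phi> \<epsilon> - Q \<epsilon> f"
  by (simp add: decomp rank_one_def)

text \<open>Since \<open>Q \<epsilon>\<close> commutes with the normalised operator, the increments of \<open>n \<mapsto> Q\<^sup>n f\<close> are
  \<open>Q\<^sup>n (f - \<lambda>\<^sup>-\<^sup>1 P f)\<close>; summing them shows that \<open>Q\<^sup>n f\<close> is small as soon as \<open>f\<close> is nearly an
  eigenvector.\<close>

lemma norm_Q_pow_le_kappa:
  "norm ((Q \<epsilon> ^^ Suc n) f) \<le> kappa Q (Suc n) * norm (f - inverse (lam \<epsilon>) *\<^sub>C P \<epsilon> f)"
proof -
  let ?d = "f - inverse (lam \<epsilon>) *\<^sub>C P \<epsilon> f"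
  have incr: "(Q \<epsilon> ^^ j) f - (Q \<epsilon> ^^ Suc j) f = (Q \<epsilon> ^^ j) ?d" if "Suc n \<le> j" for j
  proof -
    from that obtain i where j: "j = Suc i"
      by (cases j) auto
    have "(Q \<epsilon> ^^ j) (\<nu> \<epsilon> f *\<^sub>C \<phi> \<epsilon>) = 0"
      unfolding j funpow_Suc_right
      by (simp add: bounded_clinear_scaleC[OF Q_bounded] Q_right bounded_linear_0[OF Q_pow_linear])
    moreover have "(Q \<epsilon> ^^ Suc j) f = (Q \<epsilon> ^^ j) (Q \<epsilon> f)"
      by (simp add: funpow_swap1)
    ultimately show ?thesis
      unfolding diff_normalized_P bounded_linear_diff[OF Q_pow_linear] by simp
  qed
  have "norm ((Q \<epsilon> ^^ Suc n) f) \<le> (\<Sum>j. Q_sup (j + Suc n) * norm ?d)"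
    by (rule norm_le_suminf_increments[OF Q_pow_tendsto_0])
      (use Q_summable summable_mult2 in \<open>auto simp: incr simp del: funpow.simps intro: norm_Q_pow_le\<close>)
  also have "\<dots> = kappa Q (Suc n) * norm ?d"
    unfolding kappa_eq
    by (rule suminf_mult2[OF Q_sup_summable, symmetric])
  finally show ?thesis .
qed

lemma inverse_lam_le: "cmod (lam \<epsilon>) \<ge> 1 / 2 \<Longrightarrow> inverse (cmod (lam \<epsilon>)) \<le> 2"
  using le_imp_inverse_le[of "1 / 2" "cmod (lam \<epsilon>)"] by simp

lemma norm_\<phi>0_diff_normalized_le:
  assumes "cmod (lam \<epsilon>) \<ge> 1 / 2"
  shows "norm (\<phi> e0 - inverse (lam \<epsilon>) *\<^sub>C P \<epsilon> (\<phi> e0))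
    \<le> 2 * (cmod (1 - lam \<epsilon>) * norm (\<phi> e0) + norm (defect \<epsilon> (\<phi> e0)))"
proof -
  have "\<phi> e0 - inverse (lam \<epsilon>) *\<^sub>C P \<epsilon> (\<phi> e0)
      = inverse (lam \<epsilon>) *\<^sub>C (defect \<epsilon> (\<phi> e0) - (1 - lam \<epsilon>) *\<^sub>C \<phi> e0)"
    using lam_nonzero[of \<epsilon>]
    by (simp add: P0_\<phi>0 scaleC_diff_right scaleC_diff_left scaleC_scaleC scaleC_one algebra_simps)
  then have "norm (\<phi> e0 - inverse (lam \<epsilon>) *\<^sub>C P \<epsilon> (\<phi> e0))
      = inverse (cmod (lam \<epsilon>)) * norm (defect \<epsilon> (\<phi> e0) - (1 - lam \<epsilon>) *\<^sub>C \<phi> e0)"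
    by (simp add: norm_scaleC norm_inverse)
  also have "\<dots> \<le> 2 * (norm (defect \<epsilon> (\<phi> e0)) + norm ((1 - lam \<epsilon>) *\<^sub>C \<phi> e0))"
    by (intro mult_mono norm_triangle_ineq4 inverse_lam_le assms) auto
  finally show ?thesis
    by (simp add: norm_scaleC algebra_simps)
qed

text \<open>The reference functional is almost invariant under the normalised operator: what it loses is
  \<open>\<nu>\<^sub>0 (defect g)\<close> and a multiple of \<open>1 - \<lambda>\<close>, and both are of order \<open>\<eta>\<close>.  The increments of
  \<open>n \<mapsto> \<nu>\<^sub>0 (Q\<^sup>n f)\<close> are therefore of order \<open>\<eta>\<close> times summable terms.\<close>

lemma \<nu>0_remainder_bound:
  "\<exists>C\<ge>0. \<forall>\<epsilon>. cmod (lam \<epsilon>) \<ge> 1 / 2 \<longrightarrow>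
     (\<forall>n f. cmod (\<nu>0 ((Q \<epsilon> ^^ Suc n) f)) \<le> C * \<eta> \<epsilon> * norm f) \<and>
     (\<forall>f. cmod (\<nu>0 f - \<nu> \<epsilon> f) \<le> C * \<eta> \<epsilon> * norm f)"
proof -
  obtain B where B: "0 \<le> B" "\<And>\<epsilon>. cmod (1 - lam \<epsilon>) \<le> B * \<eta> \<epsilon>"
    using one_minus_lam_bound by blast
  define K where "K = 2 * (B * onorm \<nu>0 + 1)"
  have K: "0 \<le> K"
    using B(1) onorm_pos_le[OF \<nu>0_linear] by (simp add: K_def)
  have almost_inv: "cmod (\<nu>0 (g - inverse (lam \<epsilon>) *\<^sub>C P \<epsilon> g)) \<le> K * \<eta> \<epsilon> * norm g"
    if "cmod (lam \<epsilon>) \<ge> 1 / 2" for \<epsilon> g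
  proof -
    have "\<nu>0 (g - inverse (lam \<epsilon>) *\<^sub>C P \<epsilon> g)
        = inverse (lam \<epsilon>) * (\<nu>0 (defect \<epsilon> g) - (1 - lam \<epsilon>) * \<nu>0 g)"
      using lam_nonzero[of \<epsilon>]
      by (simp add: bounded_linear_diff[OF \<nu>0_linear] \<nu>0_scaleC \<nu>0_P0 algebra_simps)
    then have "cmod (\<nu>0 (g - inverse (lam \<epsilon>) *\<^sub>C P \<epsilon> g))
        = inverse (cmod (lam \<epsilon>)) * cmod (\<nu>0 (defect \<epsilon> g) - (1 - lam \<epsilon>) * \<nu>0 g)"
      by (simp add: norm_mult norm_inverse)
    also have "\<dots> \<le> 2 * (cmod (\<nu>0 (defect \<epsilon> g)) + cmod (1 - lam \<epsilon>) * cmod (\<nu>0 g))"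
      unfolding norm_mult[symmetric]
      by (intro mult_mono norm_triangle_ineq4 inverse_lam_le that) auto
    also have "\<dots> \<le> 2 * (\<eta> \<epsilon> * norm g + (B * \<eta> \<epsilon>) * (onorm \<nu>0 * norm g))"
      using B \<eta>_nonneg
      by (intro mult_left_mono add_mono mult_mono defect_functional_le onorm[OF \<nu>0_linear]) auto
    also have "\<dots> = K * \<eta> \<epsilon> * norm g"
      by (simp add: K_def algebra_simps)
    finally show ?thesis .
  qed
  define C where "C = K * kappa Q 1 + K"
  have tail: "cmod (\<nu>0 ((Q \<epsilon> ^^ Suc n) f)) \<le> K * kappa Q 1 * \<eta> \<epsilon> * norm f"
    if lam: "cmod (lam \<epsilon>) \<ge> 1 / 2" for \<epsilon> n f
  proof -
    define b where "b j = K * \<eta> \<epsilon> * (Q_sup j * norm f)" for j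
    have incr: "cmod (\<nu>0 ((Q \<epsilon> ^^ j) f) - \<nu>0 ((Q \<epsilon> ^^ Suc j) f)) \<le> b j" if j: "j \<ge> Suc n" for j
    proof -
      from j obtain i where i: "j = Suc i"
        by (cases j) auto
      have "(Q \<epsilon> ^^ j) f - (Q \<epsilon> ^^ Suc j) f
          = (Q \<epsilon> ^^ j) f - inverse (lam \<epsilon>) *\<^sub>C P \<epsilon> ((Q \<epsilon> ^^ j) f)"
        unfolding diff_normalized_P i by (simp add: Q_left)
      then have "cmod (\<nu>0 ((Q \<epsilon> ^^ j) f) - \<nu>0 ((Q \<epsilon> ^^ Suc j) f))
          \<le> K * \<eta> \<epsilon> * norm ((Q \<epsilon> ^^ j) f)"
        using almost_inv[OF lam, of "(Q \<epsilon> ^^ j) f"]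
        by (simp add: bounded_linear_diff[OF \<nu>0_linear, symmetric])
      also have "\<dots> \<le> b j"
        unfolding b_def using K \<eta>_nonneg by (intro mult_left_mono norm_Q_pow_le) auto
      finally show ?thesis .
    qed
    have summ: "summable b"
      unfolding b_def by (intro summable_mult summable_mult2 Q_summable)
    have lim: "(\<lambda>j. \<nu>0 ((Q \<epsilon> ^^ j) f)) \<longlonglongrightarrow> 0"
      using bounded_linear.tendsto[OF \<nu>0_linear Q_pow_tendsto_0[where \<epsilon> = \<epsilon> and f = f]]
      by (simp add: bounded_linear_0[OF \<nu>0_linear])
    have b_nonneg: "0 \<le> b j" for j
      unfolding b_def using K \<eta>_nonneg Q_sup_nonneg by simp
    have "cmod (\<nu>0 ((Q \<epsilon> ^^ Suc n) f)) \<le> (\<Sum>j. b (j + Suc n))"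
      by (rule norm_le_suminf_increments[OF lim summ incr])
    also have "\<dots> \<le> (\<Sum>j. b (j + 1))"
    proof -
      have s: "summable (\<lambda>j. b (j + 1))"
        using summ by (subst summable_iff_shift)
      have "(\<Sum>j. b (j + 1)) = (\<Sum>j. b (j + n + 1)) + (\<Sum>j<n. b (j + 1))"
        using suminf_split_initial_segment[OF s, of n] by simp
      moreover have "(\<Sum>j<n. b (j + 1)) \<ge> 0"
        by (intro sum_nonneg b_nonneg)
      ultimately show ?thesis by simp
    qed
    also have "\<dots> = K * kappa Q 1 * \<eta> \<epsilon> * norm f"
    proof -
      have "(\<lambda>j. b (j + 1)) sums (K * \<eta> \<epsilon> * (kappa Q 1 * norm f))"
        unfolding b_def kappa_eq by (intro sums_mult sums_mult2 summable_sums Q_sup_summable)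
      then show ?thesis
        by (simp add: sums_iff mult_ac)
    qed
    finally show ?thesis .
  qed
  have le_C: "K * kappa Q 1 * \<eta> \<epsilon> * norm f \<le> C * \<eta> \<epsilon> * norm f" for \<epsilon> f
    unfolding C_def using K \<eta>_nonneg[of \<epsilon>] by (intro mult_right_mono) auto
  have "cmod (\<nu>0 f - \<nu> \<epsilon> f) \<le> C * \<eta> \<epsilon> * norm f" if lam: "cmod (lam \<epsilon>) \<ge> 1 / 2" for \<epsilon> f
  proof -
    have "\<nu>0 f - \<nu> \<epsilon> f = \<nu>0 (f - inverse (lam \<epsilon>) *\<^sub>C P \<epsilon> f) + \<nu>0 (Q \<epsilon> f)"
      unfolding diff_normalized_P
      by (simp add: bounded_linear_diff[OF \<nu>0_linear] \<nu>0_scaleC \<phi>_normalized)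
    then have "cmod (\<nu>0 f - \<nu> \<epsilon> f) \<le> K * \<eta> \<epsilon> * norm f + K * kappa Q 1 * \<eta> \<epsilon> * norm f"
      using almost_inv[OF lam, of f] tail[OF lam, of 0 f]
      by (auto intro: norm_triangle_mono)
    then show ?thesis
      by (simp add: C_def algebra_simps)
  qed
  moreover have "0 \<le> C"
    using K kappa_nonneg by (simp add: C_def)
  ultimately show ?thesis
    using tail le_C by (meson order_trans)
qed

text \<open>The expansion of the eigenvalue: \<open>\<nu>\<^sub>\<epsilon> (\<phi>\<^sub>0) \<phi>\<^sub>\<epsilon>\<close> is \<open>\<lambda>\<^sup>-\<^sup>n P\<^sup>n \<phi>\<^sub>0\<close> up to \<open>Q\<^sup>n \<phi>\<^sub>0\<close>, and
  \<open>\<phi>\<^sub>0 - P\<^sup>n \<phi>\<^sub>0\<close> telescopes because \<open>\<phi>\<^sub>0\<close> is fixed by the unperturbed operator.\<close>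

lemma eigenvalue_expansion:
  assumes "n > 0"
  shows "\<nu> \<epsilon> (\<phi> e0) * (1 - lam \<epsilon>)
    = \<nu>0 (defect \<epsilon> (\<phi> e0)) - (\<Sum>k<n. \<nu>0 (defect \<epsilon> ((P \<epsilon> ^^ k) (defect \<epsilon> (\<phi> e0)))))
      + (inverse (lam \<epsilon>) ^ n - 1) * \<nu>0 (defect \<epsilon> ((P \<epsilon> ^^ n) (\<phi> e0)))
      - \<nu>0 (defect \<epsilon> ((Q \<epsilon> ^^ n) (\<phi> e0)))"
proof -
  let ?L = "\<lambda>f. \<nu>0 (defect \<epsilon> f)" and ?f = "\<phi> e0"
  obtain m where n: "n = Suc m"
    using assms by (cases n) auto
  have "?L ((P \<epsilon> ^^ n) ?f) = lam \<epsilon> ^ n * (\<nu> \<epsilon> ?f * ?L (\<phi> \<epsilon>) + ?L ((Q \<epsilon> ^^ n) ?f))"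
    unfolding n P_pow_decomp defect_functional_scaleC
      bounded_linear_plus[OF defect_functional_linear] ..
  then have eigen: "\<nu> \<epsilon> ?f * (1 - lam \<epsilon>)
      = inverse (lam \<epsilon>) ^ n * ?L ((P \<epsilon> ^^ n) ?f) - ?L ((Q \<epsilon> ^^ n) ?f)"
    using lam_nonzero[of \<epsilon>] by (simp add: one_minus_lam power_inverse field_simps)
  have "(\<Sum>k<n. ?L ((P \<epsilon> ^^ k) (defect \<epsilon> ?f)))
      = (\<Sum>k<n. ?L ((P \<epsilon> ^^ k) ?f) - ?L ((P \<epsilon> ^^ Suc k) ?f))"
    unfolding P0_\<phi>0 bounded_linear_diff[OF P_pow_linear]
      bounded_linear_diff[OF defect_functional_linear]
    by (simp add: funpow_swap1)
  also have "\<dots> = ?L ?f - ?L ((P \<epsilon> ^^ n) ?f)"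
    by (subst sum_lessThan_telescope') simp
  finally show ?thesis
    unfolding eigen by (simp add: algebra_simps)
qed

subsection \<open>The size of the error term\<close>

lemma Q_sup_submult: "Q_sup (m + n) \<le> Q_sup m * Q_sup n"
proof (rule cSUP_least)
  fix \<epsilon> :: 'e
  have "onorm (Q \<epsilon> ^^ (m + n)) \<le> onorm (Q \<epsilon> ^^ m) * onorm (Q \<epsilon> ^^ n)"
    unfolding funpow_add by (rule onorm_compose[OF Q_pow_linear Q_pow_linear])
  also have "\<dots> \<le> Q_sup m * Q_sup n"
    by (intro mult_mono onorm_Q_pow_le onorm_Q_pow_nonneg Q_sup_nonneg)
  finally show "onorm (Q \<epsilon> ^^ (m + n)) \<le> Q_sup m * Q_sup n" .
qed simp

lemma kappa_add_le: "kappa Q (m + N) \<le> Q_sup m * kappa Q N"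
proof -
  have "kappa Q (m + N) \<le> (\<Sum>k. Q_sup m * Q_sup (k + N))"
    unfolding kappa_eq
  proof (rule suminf_le)
    show "Q_sup (k + (m + N)) \<le> Q_sup m * Q_sup (k + N)" for k
      using Q_sup_submult[of m "k + N"] by (simp add: add_ac)
    show "summable (\<lambda>k. Q_sup (k + (m + N)))"
      by (rule Q_sup_summable)
    show "summable (\<lambda>k. Q_sup m * Q_sup (k + N))"
      by (intro summable_mult Q_sup_summable)
  qed
  then show ?thesis
    unfolding kappa_eq using suminf_mult[OF Q_sup_summable] by simp
qed

text \<open>Some \<open>m\<close> has \<open>Q_sup m < 1 / 2\<close> by summability, and each further block of length \<open>m\<close>
  halves the tail.\<close>

lemma kappa_geometric: "\<exists>m>0. \<forall>j. kappa Q (j * m) \<le> (1 / 2) ^ j * kappa Q 0"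
proof -
  have "\<forall>\<^sub>F n in sequentially. Q_sup n < 1 / 2"
    using summable_LIMSEQ_zero[OF Q_summable] by (rule order_tendstoD) simp
  moreover have "\<forall>\<^sub>F n in sequentially. n > (0 :: nat)"
    by (rule eventually_gt_at_top)
  ultimately have "\<forall>\<^sub>F n in sequentially. Q_sup n < 1 / 2 \<and> n > 0"
    by (rule eventually_conj)
  then obtain m where m: "Q_sup m < 1 / 2" "m > 0"
    by (auto simp: eventually_sequentially)
  have "kappa Q (j * m) \<le> (1 / 2) ^ j * kappa Q 0" for j
  proof (induction j)
    case (Suc j)
    have "kappa Q (Suc j * m) \<le> Q_sup m * kappa Q (j * m)"
      using kappa_add_le[of m "j * m"] by simp
    also have "\<dots> \<le> 1 / 2 * ((1 / 2) ^ j * kappa Q 0)"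
      using m Suc by (intro mult_mono) (auto simp: kappa_nonneg)
    finally show ?case by simp
  qed simp
  with m show ?thesis by blast
qed

lemma bdd_below_delta: "bdd_below ((\<lambda>N. real N * \<eta> \<epsilon> + kappa Q N) ` {1..})"
  by (rule bdd_belowI[of _ 0]) (auto intro!: add_nonneg_nonneg mult_nonneg_nonneg \<eta>_nonneg kappa_nonneg)

lemma delta_le: "N \<ge> 1 \<Longrightarrow> delta \<nu>0 e0 P Q \<epsilon> \<le> real N * \<eta> \<epsilon> + kappa Q N"
  unfolding delta_def by (rule cINF_lower[OF bdd_below_delta]) simp

lemma \<eta>_le_delta: "\<eta> \<epsilon> \<le> delta \<nu>0 e0 P Q \<epsilon>"
  unfolding delta_def
proof (rule cINF_greatest)
  fix N :: nat
  assume "N \<in> {1..}"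
  then have "1 * \<eta> \<epsilon> \<le> real N * \<eta> \<epsilon>"
    by (intro mult_right_mono \<eta>_nonneg) auto
  then show "\<eta> \<epsilon> \<le> real N * \<eta> \<epsilon> + kappa Q N"
    using kappa_nonneg[of N] by simp
qed auto

text \<open>The number \<open>N\<close> in the definition of \<open>\<delta>\<close> is taken proportional to \<open>|ln \<eta>|\<close>, the time after
  which the geometrically decaying \<open>\<kappa>\<^sub>N\<close> has dropped to the order of \<open>\<eta>\<close>.\<close>

lemma delta_bigo:
  assumes lim: "(\<eta> \<longlongrightarrow> 0) F" and pos: "\<forall>\<^sub>F \<epsilon> in F. \<eta> \<epsilon> > 0"
  shows "delta \<nu>0 e0 P Q \<in> O[F](\<lambda>\<epsilon>. \<bar>\<eta> \<epsilon> * ln (\<eta> \<epsilon>)\<bar>)"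
proof -
  obtain m where m: "m > 0" "\<And>j. kappa Q (j * m) \<le> (1 / 2) ^ j * kappa Q 0"
    using kappa_geometric by blast
  define c where "c = real m * (1 / ln 2 + 1) + kappa Q 0"
  have "\<forall>\<^sub>F \<epsilon> in F. \<eta> \<epsilon> < exp (- 1)"
    using lim by (rule order_tendstoD) simp
  with pos have "\<forall>\<^sub>F \<epsilon> in F. norm (delta \<nu>0 e0 P Q \<epsilon>) \<le> c * norm \<bar>\<eta> \<epsilon> * ln (\<eta> \<epsilon>)\<bar>"
  proof eventually_elim
    case (elim \<epsilon>)
    define l where "l = - ln (\<eta> \<epsilon>)"
    have "ln (\<eta> \<epsilon>) < ln (exp (- 1))"
      using elim by (subst ln_less_cancel_iff) auto
    then have l: "l > 1"
      by (simp add: l_def)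
    \<comment> \<open>so many blocks of length \<open>m\<close> bring the geometric bound below \<open>\<eta>\<close>\<close>
    define j where "j = nat \<lceil>l / ln 2\<rceil>"
    have l_pos: "0 < l / ln 2"
      using l by simp
    have j_ge: "l / ln 2 \<le> real j"
      unfolding j_def by (rule real_nat_ceiling_ge)
    have j_le: "real j \<le> l / ln 2 + 1"
      unfolding j_def using l_pos by linarith
    from j_ge l_pos have j_pos: "j > 0"
      by (cases j) auto
    have "(1 / 2 :: real) ^ j = exp (- (real j * ln 2))"
      by (simp add: exp_minus exp_of_nat_mult power_one_over inverse_eq_divide)
    also have "\<dots> \<le> exp (- l)"
      using j_ge by (simp add: divide_le_eq)
    also have "\<dots> = \<eta> \<epsilon>"
      using elim by (simp add: l_def)
    finally have "kappa Q (j * m) \<le> \<eta> \<epsilon> * kappa Q 0"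
      using m(2)[of j] mult_right_mono[OF _ kappa_nonneg[of 0]] order_trans by blast
    moreover have "\<eta> \<epsilon> * kappa Q 0 \<le> \<eta> \<epsilon> * l * kappa Q 0"
      using l elim by (intro mult_right_mono kappa_nonneg) auto
    moreover have "real (j * m) * \<eta> \<epsilon> \<le> (real m * (1 / ln 2 + 1) * l) * \<eta> \<epsilon>"
    proof (rule mult_right_mono[OF _ \<eta>_nonneg])
      have "real j \<le> (1 / ln 2 + 1) * l"
        using j_le l by (simp add: algebra_simps)
      then have "real m * real j \<le> real m * ((1 / ln 2 + 1) * l)"
        by (rule mult_left_mono) simp
      then show "real (j * m) \<le> real m * (1 / ln 2 + 1) * l"
        by (simp add: mult_ac)
    qed
    moreover have "delta \<nu>0 e0 P Q \<epsilon> \<le> real (j * m) * \<eta> \<epsilon> + kappa Q (j * m)"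
      using j_pos m(1) by (intro delta_le) (simp add: Suc_le_eq)
    ultimately have "delta \<nu>0 e0 P Q \<epsilon> \<le> c * (\<eta> \<epsilon> * l)"
      by (simp add: c_def algebra_simps)
    moreover have "norm (delta \<nu>0 e0 P Q \<epsilon>) = delta \<nu>0 e0 P Q \<epsilon>"
      using order_trans[OF \<eta>_nonneg \<eta>_le_delta[of \<epsilon>]] by simp
    moreover have "norm \<bar>\<eta> \<epsilon> * ln (\<eta> \<epsilon>)\<bar> = \<eta> \<epsilon> * l"
      using elim l by (simp add: l_def abs_mult)
    ultimately show ?case by simp
  qed
  then show ?thesis
    by (rule bigoI)
qed

subsection \<open>The Lasota-Yorke inequality makes the perturbation small\<close>

lemma remainder_e0: "(P e0 ^^ Suc n) f = \<nu>0 f *\<^sub>C \<phi> e0 + (Q e0 ^^ Suc n) f"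
  using P_pow_decomp[where \<epsilon> = e0] by (simp add: lam_e0 scaleC_one \<nu>_e0 del: funpow.simps)

text \<open>Iterating the unperturbed operator turns the weak norm into a bound for \<open>\<nu>\<^sub>0\<close>: in the limit
  \<open>P\<^sup>n f \<rightarrow> \<nu>\<^sub>0 (f) \<phi>\<^sub>0\<close>, and \<open>\<phi>\<^sub>0\<close>, being a fixed point, has positive weak norm.\<close>

lemma \<eta>_tendsto_0:
  assumes "uniform_lasota_yorke P e0"
  shows "(\<eta> \<longlongrightarrow> 0) (at e0)"
proof -
  obtain \<alpha> D w \<pi> where \<alpha>: "0 < \<alpha>" "\<alpha> < 1" and D: "0 < D" and w: "seminorm w" "\<And>f. w f \<le> norm f"
    and weak: "\<And>\<epsilon> f n. w ((P \<epsilon> ^^ n) f) \<le> D * w f"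
    and ly: "\<And>\<epsilon> f n. norm ((P \<epsilon> ^^ n) f) \<le> D * \<alpha> ^ n * norm f + D * w f"
    and \<pi>: "\<And>\<epsilon>. 0 \<le> \<pi> \<epsilon>" "(\<pi> \<longlongrightarrow> 0) (at e0)"
    and close: "\<And>\<epsilon> f. w (P \<epsilon> f - P e0 f) \<le> \<pi> \<epsilon> * norm f"
    using assms unfolding uniform_lasota_yorke_def by blast
  have w_add: "w (f + h) \<le> w f + w h" and w_scale: "w (c *\<^sub>C f) = cmod c * w f" for f h c
    using w(1) by (auto simp: seminorm_def)
  have fixed: "(P e0 ^^ n) (\<phi> e0) = \<phi> e0" for n
    by (induction n) (auto simp: P0_\<phi>0)
  have "norm (\<phi> e0) \<le> D * w (\<phi> e0)"
  proof (rule LIMSEQ_le_const)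
    show "(\<lambda>n. D * \<alpha> ^ n * norm (\<phi> e0) + D * w (\<phi> e0)) \<longlonglongrightarrow> D * w (\<phi> e0)"
      using \<alpha> by (auto intro!: tendsto_eq_intros LIMSEQ_power_zero)
    show "\<exists>N. \<forall>n\<ge>N. norm (\<phi> e0) \<le> D * \<alpha> ^ n * norm (\<phi> e0) + D * w (\<phi> e0)"
      using ly[where \<epsilon> = e0 and f = "\<phi> e0"] by (auto simp: fixed)
  qed
  then have "0 < D * w (\<phi> e0)"
    using \<phi>_nonzero[of e0] by (smt (verit) zero_less_norm_iff)
  then have w_pos: "0 < w (\<phi> e0)"
    using D by (simp add: zero_less_mult_iff)
  have \<nu>0_weak: "cmod (\<nu>0 f) * w (\<phi> e0) \<le> D * w f" for f
  proof (rule LIMSEQ_le_const)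
    have "(\<lambda>n. norm ((Q e0 ^^ Suc n) f)) \<longlonglongrightarrow> 0"
      using Q_pow_tendsto_0[where \<epsilon> = e0 and f = f, THEN tendsto_norm_zero] by (rule LIMSEQ_Suc)
    from tendsto_add[OF tendsto_const this]
    show "(\<lambda>n. D * w f + norm ((Q e0 ^^ Suc n) f)) \<longlonglongrightarrow> D * w f"
      by (simp del: funpow.simps)
    have "cmod (\<nu>0 f) * w (\<phi> e0) \<le> D * w f + norm ((Q e0 ^^ Suc n) f)" for n
    proof -
      have "cmod (\<nu>0 f) * w (\<phi> e0) = w (\<nu>0 f *\<^sub>C \<phi> e0)"
        by (simp add: w_scale)
      also have "\<nu>0 f *\<^sub>C \<phi> e0 = (P e0 ^^ Suc n) f + (- 1) *\<^sub>C (Q e0 ^^ Suc n) f"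
        using scaleC_diff_left[of 0 1 "(Q e0 ^^ Suc n) f"]
        unfolding remainder_e0 by (simp add: scaleC_one del: funpow.simps)
      also have "w \<dots> \<le> w ((P e0 ^^ Suc n) f) + w ((- 1) *\<^sub>C (Q e0 ^^ Suc n) f)"
        by (rule w_add)
      also have "w ((- 1) *\<^sub>C (Q e0 ^^ Suc n) f) = w ((Q e0 ^^ Suc n) f)"
        unfolding w_scale by simp
      also have "w ((P e0 ^^ Suc n) f) + w ((Q e0 ^^ Suc n) f) \<le> D * w f + norm ((Q e0 ^^ Suc n) f)"
        by (intro add_mono weak w(2))
      finally show ?thesis .
    qed
    then show "\<exists>N. \<forall>n\<ge>N. cmod (\<nu>0 f) * w (\<phi> e0) \<le> D * w f + norm ((Q e0 ^^ Suc n) f)"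
      by blast
  qed
  have bound: "\<eta> \<epsilon> \<le> D / w (\<phi> e0) * \<pi> \<epsilon>" for \<epsilon>
    unfolding eta_def
  proof (rule onorm_bound)
    show "0 \<le> D / w (\<phi> e0) * \<pi> \<epsilon>"
      using D w_pos \<pi>(1) by simp
    fix f
    have "cmod (\<nu>0 (defect \<epsilon> f)) = cmod (\<nu>0 (P \<epsilon> f - P e0 f))"
      by (simp add: bounded_linear_diff[OF \<nu>0_linear] norm_minus_commute)
    also have "\<dots> \<le> D * w (P \<epsilon> f - P e0 f) / w (\<phi> e0)"
      using \<nu>0_weak[of "P \<epsilon> f - P e0 f"] w_pos by (simp add: pos_le_divide_eq)
    also have "\<dots> \<le> D * (\<pi> \<epsilon> * norm f) / w (\<phi> e0)"
      using D w_pos close by (intro divide_right_mono mult_left_mono) auto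
    finally show "cmod (\<nu>0 (defect \<epsilon> f)) \<le> D / w (\<phi> e0) * \<pi> \<epsilon> * norm f"
      by simp
  qed
  show ?thesis
  proof (rule tendsto_sandwich[OF always_eventually always_eventually tendsto_const])
    show "((\<lambda>\<epsilon>. D / w (\<phi> e0) * \<pi> \<epsilon>) \<longlongrightarrow> 0) (at e0)"
      using tendsto_mult_left[OF \<pi>(2), of "D / w (\<phi> e0)"] by simp
  qed (use bound \<eta>_nonneg in auto)
qed

end

section \<open>Powers of the perturbed operator and hitting events\<close>

text \<open>A hitting time is an integer or infinite, so a real threshold may be rounded up.\<close>

lemma ereal_le_hitting_time_iff:
  "ereal s \<le> ereal_of_enat (hitting_time T B x) \<longleftrightarrow> (\<forall>i < nat \<lceil>s\<rceil>. (T ^^ i) x \<notin> B)"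
proof -
  have "ereal s \<le> ereal_of_enat e \<longleftrightarrow> enat (nat \<lceil>s\<rceil>) \<le> e" for e
    by (cases e) (auto simp: nat_le_iff ceiling_le_iff)
  then have "ereal s \<le> ereal_of_enat (hitting_time T B x) \<longleftrightarrow>
      (\<forall>i. (T ^^ i) x \<in> B \<longrightarrow> nat \<lceil>s\<rceil> \<le> i)"
    by (simp add: hitting_time_def le_INF_iff)
  then show ?thesis
    using not_le by blast
qed

context repfo
begin

abbreviation \<nu>\<^sub>0 :: "'v \<Rightarrow> complex" where
  "\<nu>\<^sub>0 \<equiv> ref_functional N0 rep"

lemma test_1: "(\<lambda>_. 1) \<in> \<T>"
  and test_add: "g \<in> \<T> \<Longrightarrow> h \<in> \<T> \<Longrightarrow> (\<lambda>x. g x + h x) \<in> \<T>"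
  and test_scale: "g \<in> \<T> \<Longrightarrow> (\<lambda>x. c * g x) \<in> \<T>"
  and test_restrict: "g \<in> \<T> \<Longrightarrow> (\<lambda>x. indicator (A \<epsilon>) x * g x) \<in> \<T>"
  and test_comp: "g \<in> \<T> \<Longrightarrow> g \<circ> T \<in> \<T>"
  and test_borel: "g \<in> \<T> \<Longrightarrow> g \<in> borel_measurable borel"
  using test by (auto simp: test_functions_def)

lemma test_restrict_compl:
  assumes "g \<in> \<T>"
  shows "(\<lambda>x. indicator (- A \<epsilon>) x * g x) \<in> \<T>"
proof -
  have "(\<lambda>x. g x + (- 1) * (indicator (A \<epsilon>) x * g x)) \<in> \<T>"
    using assms by (intro test_add test_scale test_restrict)
  also have "(\<lambda>x. g x + (- 1) * (indicator (A \<epsilon>) x * g x)) = (\<lambda>x. indicator (- A \<epsilon>) x * g x)"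
    by (auto simp: indicator_def)
  finally show ?thesis .
qed

lemma inj_rep: "inj rep"
  using V_space
  by (auto simp: gfun_space_def function_space_def distribution_space_def inj_def)

lemma rep_ind_mult: "rep (ind_mult \<T> rep (A \<epsilon>) f) = gmult \<T> (indicator (A \<epsilon>)) (rep f)"
  unfolding ind_mult_def by (rule f_inv_into_f[OF ind_mult_closed])

lemma pairing_gmult:
  "g \<in> \<T> \<Longrightarrow> pairing N0 (gmult \<T> b u) g = pairing N0 u (\<lambda>x. b x * g x)"
  by (cases u) (simp_all add: mult_ac)

text \<open>Multiplication by the indicator of the complement is subtraction of the product with the
  indicator, hence leaves the space invariant, too.\<close>

lemma rep_diff_ind_mult:
  "rep (f - ind_mult \<T> rep (A \<epsilon>) f) = gmult \<T> (indicator (- A \<epsilon>)) (rep f)"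
proof -
  let ?h = "ind_mult \<T> rep (A \<epsilon>) f"
  note h = rep_ind_mult[of \<epsilon> f]
  from V_space consider
      F where "rep = (\<lambda>f. Function (F f))" "function_space N0 F"
    | U where "rep = (\<lambda>f. Distribution (U f))" "distribution_space N0 \<T> U"
    unfolding gfun_space_def by blast
  then show ?thesis
  proof cases
    case 1
    have "F (f - ?h) x + F ?h x = F f x" for x
      using 1(2) unfolding function_space_def by (metis diff_add_cancel)
    moreover have "F ?h x = indicator (A \<epsilon>) x * F f x" for x
      using h by (simp add: 1(1) fun_eq_iff)
    ultimately have "F (f - ?h) x = indicator (- A \<epsilon>) x * F f x" for x
      by (cases "x \<in> A \<epsilon>") (metis add_cancel_left_left indicator_simps mult_1 mult_zero_left
          add.right_neutral ComplD ComplI)+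
    then show ?thesis
      by (simp add: 1(1) fun_eq_iff)
  next
    case 2
    have add: "U u (\<lambda>x. g x + h x) = U u g + U u h" if "g \<in> \<T>" "h \<in> \<T>" for u g h
      using 2(2) that unfolding distribution_space_def by blast
    have "U (f - ?h) g = U f (\<lambda>x. indicator (- A \<epsilon>) x * g x)" if g: "g \<in> \<T>" for g
    proof -
      have "U ((f - ?h) + ?h) g = U (f - ?h) g + U ?h g"
        using 2(2) g unfolding distribution_space_def by blast
      moreover have "U ?h g = U f (\<lambda>x. indicator (A \<epsilon>) x * g x)"
        using h g by (simp add: 2(1))
      moreover have "U f (\<lambda>x. indicator (- A \<epsilon>) x * g x + indicator (A \<epsilon>) x * g x)
          = U f (\<lambda>x. indicator (- A \<epsilon>) x * g x) + U f (\<lambda>x. indicator (A \<epsilon>) x * g x)"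
        by (rule add[OF test_restrict_compl[OF g] test_restrict[OF g]])
      moreover have "(\<lambda>x. indicator (- A \<epsilon>) x * g x + indicator (A \<epsilon>) x * g x) = g"
        by (auto simp: indicator_def)
      ultimately show ?thesis by simp
    qed
    moreover have "U (f - ?h) \<in> extensional \<T>"
      using 2(2) by (simp add: distribution_space_def)
    ultimately have "U (f - ?h) = (\<lambda>g\<in>\<T>. U f (\<lambda>x. indicator (- A \<epsilon>) x * g x))"
      by (intro extensionalityI[of _ \<T>]) auto
    then show ?thesis
      by (simp add: 2(1))
  qed
qed

lemma ind_mult_compl: "ind_mult \<T> rep (- A \<epsilon>) f = f - ind_mult \<T> rep (A \<epsilon>) f"
  unfolding ind_mult_def[of \<T> rep "- A \<epsilon>"] rep_diff_ind_mult[symmetric]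
  by (rule inv_f_f[OF inj_rep])

lemma pairing_P:
  assumes "\<epsilon> \<noteq> e0" "g \<in> \<T>"
  shows "pairing N0 (rep (P \<epsilon> f)) g = pairing N0 (rep f) (\<lambda>x. indicator (- A \<epsilon>) x * g (T x))"
  using assms test_comp[of g]
  by (simp add: P_def ind_mult_compl P0_dual rep_diff_ind_mult pairing_gmult)

text \<open>Duality moves the operator onto the test function, where \<open>n\<close> steps compose it with \<open>T\<^sup>n\<close> and
  restrict it to the orbits that have not met the hole.  That the resulting function is again a
  test function is part of the induction, because duality holds for test functions only.\<close>

lemma pairing_P_pow:
  assumes "\<epsilon> \<noteq> e0" "g \<in> \<T>"
  shows "pairing N0 (rep ((P \<epsilon> ^^ n) f)) g
      = pairing N0 (rep f) (\<lambda>x. indicator {x. \<forall>i<n. (T ^^ i) x \<notin> A \<epsilon>} x * g ((T ^^ n) x)) \<and>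
    (\<lambda>x. indicator {x. \<forall>i<n. (T ^^ i) x \<notin> A \<epsilon>} x * g ((T ^^ n) x)) \<in> \<T>"
proof (induction n arbitrary: f)
  case 0
  show ?case using assms by simp
next
  case (Suc n)
  let ?g = "\<lambda>n x. indicator {x. \<forall>i<n. (T ^^ i) x \<notin> A \<epsilon>} x * g ((T ^^ n) x)"
  have step: "(\<lambda>x. indicator (- A \<epsilon>) x * ?g n (T x)) = ?g (Suc n)"
    by (rule ext) (auto simp: indicator_def All_less_Suc2 funpow_swap1)
  have "pairing N0 (rep ((P \<epsilon> ^^ Suc n) f)) g = pairing N0 (rep (P \<epsilon> f)) (?g n)"
    using Suc[of "P \<epsilon> f"] by (simp add: funpow_swap1)
  also have "\<dots> = pairing N0 (rep f) (?g (Suc n))"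
    using Suc by (subst pairing_P[OF assms(1)]) (simp_all only: step)
  finally have 1: "pairing N0 (rep ((P \<epsilon> ^^ Suc n) f)) g = pairing N0 (rep f) (?g (Suc n))" .
  have "?g (Suc n) \<in> \<T>"
    using test_restrict_compl[OF test_comp[of "?g n"], of \<epsilon>] Suc
    unfolding step[symmetric] by (simp add: o_def)
  with 1 show ?case by blast
qed

lemma pairing_survival:
  assumes "\<epsilon> \<noteq> e0"
  shows "\<nu>\<^sub>0 ((P \<epsilon> ^^ n) f) = pairing N0 (rep f) (indicator {x. \<forall>i<n. (T ^^ i) x \<notin> A \<epsilon>})"
    and "indicator {x. \<forall>i<n. (T ^^ i) x \<notin> A \<epsilon>} \<in> \<T>"
  using pairing_P_pow[OF assms test_1, of n f] by (simp_all add: ref_functional_def)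

lemma indicator_test: "indicator (A \<epsilon>) \<in> \<T>"
  using test_restrict[OF test_1] by simp

lemma defect_eq: "\<epsilon> \<noteq> e0 \<Longrightarrow> P e0 f - P \<epsilon> f = P e0 (ind_mult \<T> rep (A \<epsilon>) f)"
  by (simp add: P_def ind_mult_compl
      bounded_linear_diff[OF bounded_clinear_imp_bounded_linear[OF P0_bounded]])

lemma defect_functional_ind_mult:
  "\<epsilon> \<noteq> e0 \<Longrightarrow> \<nu>\<^sub>0 (P e0 f - P \<epsilon> f) = \<nu>\<^sub>0 (ind_mult \<T> rep (A \<epsilon>) f)"
  by (simp add: defect_eq mix_left)

lemma ref_functional_ind_mult:
  "\<nu>\<^sub>0 (ind_mult \<T> rep (A \<epsilon>) f) = pairing N0 (rep f) (indicator (A \<epsilon>))"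
  by (simp add: ref_functional_def rep_ind_mult pairing_gmult test_1)

lemma defect_P_pow:
  assumes "\<epsilon> \<noteq> e0"
  shows "\<nu>\<^sub>0 (P e0 ((P \<epsilon> ^^ n) f) - P \<epsilon> ((P \<epsilon> ^^ n) f))
      = pairing N0 (rep f) (indicator {x. (\<forall>i<n. (T ^^ i) x \<notin> A \<epsilon>) \<and> (T ^^ n) x \<in> A \<epsilon>})" (is ?eq)
    and "indicator {x. (\<forall>i<n. (T ^^ i) x \<notin> A \<epsilon>) \<and> (T ^^ n) x \<in> A \<epsilon>} \<in> \<T>" (is ?test)
proof -
  have "(\<lambda>x. indicator {x. \<forall>i<n. (T ^^ i) x \<notin> A \<epsilon>} x * indicator (A \<epsilon>) ((T ^^ n) x))
      = (indicator {x. (\<forall>i<n. (T ^^ i) x \<notin> A \<epsilon>) \<and> (T ^^ n) x \<in> A \<epsilon>} :: 'm \<Rightarrow> complex)"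
    by (auto simp: indicator_def)
  then show ?eq ?test
    using pairing_P_pow[OF assms indicator_test[of \<epsilon>], of n f]
    by (simp_all add: defect_functional_ind_mult assms ref_functional_ind_mult)
qed

text \<open>The operator \<open>P e0 - P \<epsilon>\<close> keeps what \<open>P \<epsilon>\<close> discards, so that the inner one makes the orbit
  start in the hole, the powers keep it outside, and the outer one makes it end in the hole.\<close>

lemma defect_P_pow_defect:
  fixes k :: nat and f :: 'v
  assumes "\<epsilon> \<noteq> e0"
  defines "R \<equiv> {x \<in> A \<epsilon>. (\<forall>i\<in>{1..k}. (T ^^ i) x \<notin> A \<epsilon>) \<and> (T ^^ (k + 1)) x \<in> A \<epsilon>}"
  defines "d \<equiv> P e0 f - P \<epsilon> f"
  shows "\<nu>\<^sub>0 (P e0 ((P \<epsilon> ^^ k) d) - P \<epsilon> ((P \<epsilon> ^^ k) d)) = pairing N0 (rep f) (indicator R)"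
    and "indicator R \<in> \<T>"
proof -
  let ?S = "{x. (\<forall>i<k. (T ^^ i) x \<notin> A \<epsilon>) \<and> (T ^^ k) x \<in> A \<epsilon>}"
  note S = defect_P_pow(2)[OF assms(1), of k]
  have T_pow: "(T ^^ i) (T x) = (T ^^ (i + 1)) x" for i x
    by (simp add: funpow_swap1)
  have returns: "(\<forall>i<k. (T ^^ (i + 1)) x \<notin> A \<epsilon>) \<longleftrightarrow> (\<forall>i\<in>{1..k}. (T ^^ i) x \<notin> A \<epsilon>)" for x
    unfolding image_Suc_lessThan[symmetric] Suc_eq_plus1[symmetric] by blast
  have R: "R = {x \<in> A \<epsilon>. T x \<in> ?S}"
    unfolding R_def mem_Collect_eq T_pow returns ..
  have "(\<lambda>x. indicator (A \<epsilon>) x * (indicator X \<circ> T) x)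
      = (indicator {x \<in> A \<epsilon>. T x \<in> X} :: 'm \<Rightarrow> complex)" for X
    by (auto simp: indicator_def)
  then have shift: "(\<lambda>x. indicator (A \<epsilon>) x * (indicator ?S \<circ> T) x) = (indicator R :: 'm \<Rightarrow> complex)"
    unfolding R .
  have "\<nu>\<^sub>0 (P e0 ((P \<epsilon> ^^ k) d) - P \<epsilon> ((P \<epsilon> ^^ k) d)) = pairing N0 (rep d) (indicator ?S)"
    by (rule defect_P_pow(1)[OF assms(1)])
  also have "\<dots> = pairing N0 (rep (ind_mult \<T> rep (A \<epsilon>) f)) (indicator ?S \<circ> T)"
    unfolding d_def defect_eq[OF assms(1)] by (rule P0_dual[OF S])
  also have "\<dots> = pairing N0 (rep f) (indicator R)"
    unfolding rep_ind_mult pairing_gmult[OF test_comp[OF S]] shift ..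
  finally show "\<nu>\<^sub>0 (P e0 ((P \<epsilon> ^^ k) d) - P \<epsilon> ((P \<epsilon> ^^ k) d)) = pairing N0 (rep f) (indicator R)" .
  show "indicator R \<in> \<T>"
    using test_restrict[OF test_comp[OF S], of \<epsilon>] unfolding shift .
qed

end

section \<open>The escape rate and the extremal index\<close>

text \<open>At a parameter that is not isolated the limits \<open>q k\<close> inherit from the return ratios that they
  are nonnegative with sum at most \<open>1\<close>; at an isolated one they would be arbitrary numbers.\<close>

locale rare_event_limit =
  repfo T N0 \<T> rep e0 A P "\<phi> e0" "Q e0" +
  repfo_spectral "ref_functional N0 rep" e0 P lam \<phi> \<nu> Q
  for T :: "'m::metric_space \<Rightarrow> 'm"
    and N0 :: "'m measure"
    and \<T> :: "('m \<Rightarrow> complex) set"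
    and rep :: "'v::complex_banach \<Rightarrow> 'm gfun"
    and e0 :: "'e::topological_space"
    and A :: "'e \<Rightarrow> 'm set"
    and P Q :: "'e \<Rightarrow> 'v \<Rightarrow> 'v"
    and lam :: "'e \<Rightarrow> complex"
    and \<phi> :: "'e \<Rightarrow> 'v"
    and \<nu> :: "'e \<Rightarrow> 'v \<Rightarrow> complex" +
  fixes \<mu>0 :: "'m measure"
    and q :: "nat \<Rightarrow> real"
  assumes \<mu>0: "invariant_measure_of T N0 \<T> (rep (\<phi> e0)) \<mu>0"
    and A_positive: "\<epsilon> \<noteq> e0 \<Longrightarrow> measure \<mu>0 (A \<epsilon>) > 0"
    and q_limit: "((\<lambda>\<epsilon>. return_ratio \<mu>0 T (A \<epsilon>) k) \<longlongrightarrow> q k) (at e0)"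
    and not_isolated: "at e0 \<noteq> bot"
begin

abbreviation mass :: "'e \<Rightarrow> real" where
  "mass \<epsilon> \<equiv> measure \<mu>0 (A \<epsilon>)"

abbreviation \<rho> :: "'e \<Rightarrow> nat \<Rightarrow> real" where
  "\<rho> \<epsilon> \<equiv> return_ratio \<mu>0 T (A \<epsilon>)"

sublocale \<mu>0: prob_space \<mu>0
  using \<mu>0 by (simp add: invariant_measure_of_def)

lemma sets_\<mu>0: "sets \<mu>0 = sets borel"
  using \<mu>0 by (simp add: invariant_measure_of_def)

lemma space_\<mu>0: "space \<mu>0 = UNIV"
  using sets_eq_imp_space_eq[OF sets_\<mu>0] by simp

lemma indicator_test_imp_sets: "(indicator B :: 'm \<Rightarrow> complex) \<in> \<T> \<Longrightarrow> B \<in> sets borel"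
  using test_borel borel_measurable_indicator_iff[of B borel] by auto

lemma pairing_\<phi>0:
  "indicator B \<in> \<T> \<Longrightarrow> pairing N0 (rep (\<phi> e0)) (indicator B) = complex_of_real (measure \<mu>0 B)"
  using \<mu>0 indicator_test_imp_sets by (simp add: invariant_measure_of_def)

lemma survival_measure:
  assumes "\<epsilon> \<noteq> e0"
  shows "\<nu>\<^sub>0 ((P \<epsilon> ^^ n) (\<phi> e0))
    = complex_of_real (measure \<mu>0 {x. \<forall>i<n. (T ^^ i) x \<notin> A \<epsilon>})"
  unfolding pairing_survival(1)[OF assms] by (rule pairing_\<phi>0[OF pairing_survival(2)[OF assms]])

lemma defect_\<phi>0: "\<epsilon> \<noteq> e0 \<Longrightarrow> \<nu>\<^sub>0 (defect \<epsilon> (\<phi> e0)) = complex_of_real (mass \<epsilon>)"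
  by (simp add: defect_functional_ind_mult ref_functional_ind_mult pairing_\<phi>0 indicator_test)

lemma measure_vimage_T: "B \<in> sets borel \<Longrightarrow> measure \<mu>0 (T -` B) = measure \<mu>0 B"
proof -
  assume B: "B \<in> sets borel"
  have "T \<in> measurable \<mu>0 borel"
    using T_measurable measurable_cong_sets[OF sets_\<mu>0 refl] by blast
  from measure_distr[OF this B] show ?thesis
    using \<mu>0 by (simp add: invariant_measure_of_def space_\<mu>0)
qed

lemma measure_vimage_T_pow:
  assumes "B \<in> sets borel"
  shows "measure \<mu>0 ((T ^^ n) -` B) = measure \<mu>0 B \<and> (T ^^ n) -` B \<in> sets borel"
proof (induction n)
  case 0
  show ?case using assms by simp
next
  case (Suc n)
  have pow: "(T ^^ Suc n) -` B = T -` ((T ^^ n) -` B)"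
    by (auto simp: funpow_swap1)
  have "T -` ((T ^^ n) -` B) \<in> sets borel"
    using measurable_sets[OF T_measurable, of "(T ^^ n) -` B"] Suc by simp
  then show ?case
    unfolding pow using Suc measure_vimage_T by simp
qed

lemma defect_P_pow_\<phi>0_le:
  assumes "\<epsilon> \<noteq> e0"
  shows "cmod (\<nu>\<^sub>0 (defect \<epsilon> ((P \<epsilon> ^^ n) (\<phi> e0)))) \<le> mass \<epsilon>"
proof -
  let ?S = "{x. (\<forall>i<n. (T ^^ i) x \<notin> A \<epsilon>) \<and> (T ^^ n) x \<in> A \<epsilon>}"
  note S = measure_vimage_T_pow[OF A_sets, of n \<epsilon>]
  have "cmod (\<nu>\<^sub>0 (defect \<epsilon> ((P \<epsilon> ^^ n) (\<phi> e0)))) = measure \<mu>0 ?S"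
    unfolding defect_P_pow(1)[OF assms] pairing_\<phi>0[OF defect_P_pow(2)[OF assms]] by simp
  also have "\<dots> \<le> measure \<mu>0 ((T ^^ n) -` A \<epsilon>)"
    using S by (intro \<mu>0.finite_measure_mono) (auto simp: sets_\<mu>0)
  finally show ?thesis
    using S by simp
qed

subsection \<open>Return probabilities\<close>

abbreviation first_return :: "'e \<Rightarrow> nat \<Rightarrow> 'm set" where
  "first_return \<epsilon> k \<equiv>
     {x \<in> A \<epsilon>. (\<forall>i\<in>{1..k}. (T ^^ i) x \<notin> A \<epsilon>) \<and> (T ^^ (k + 1)) x \<in> A \<epsilon>}"

lemma measure_first_return: "\<epsilon> \<noteq> e0 \<Longrightarrow> measure \<mu>0 (first_return \<epsilon> k) = \<rho> \<epsilon> k * mass \<epsilon>"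
  using A_positive[of \<epsilon>] by (simp add: return_ratio_def)

lemma defect_P_pow_defect_\<phi>0:
  assumes "\<epsilon> \<noteq> e0"
  shows "\<nu>\<^sub>0 (defect \<epsilon> ((P \<epsilon> ^^ k) (defect \<epsilon> (\<phi> e0)))) = complex_of_real (\<rho> \<epsilon> k * mass \<epsilon>)"
  unfolding measure_first_return[OF assms, symmetric]
    defect_P_pow_defect(1)[OF assms] pairing_\<phi>0[OF defect_P_pow_defect(2)[OF assms]] ..

lemma \<rho>_nonneg: "0 \<le> \<rho> \<epsilon> k"
  by (simp add: return_ratio_def)

text \<open>Orbits with different first return times form disjoint parts of the hole.  This makes the
  limits \<open>q k\<close> summable, so that their infinite sum is meaningful.\<close>

lemma \<rho>_sum_le_1:
  assumes "\<epsilon> \<noteq> e0"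
  shows "(\<Sum>k<n. \<rho> \<epsilon> k) \<le> 1"
proof -
  have sets: "first_return \<epsilon> k \<in> sets \<mu>0" for k
    unfolding sets_\<mu>0 by (rule indicator_test_imp_sets[OF defect_P_pow_defect(2)[OF assms]])
  have later: "first_return \<epsilon> j \<inter> first_return \<epsilon> k = {}" if "j < k" for j k
  proof -
    have "j + 1 \<in> {1..k}"
      using that by simp
    then show ?thesis by blast
  qed
  have disj: "disjoint_family_on (first_return \<epsilon>) {..<n}"
    unfolding disjoint_family_on_def
  proof (intro ballI impI)
    fix j k :: nat
    assume "j \<noteq> k"
    then show "first_return \<epsilon> j \<inter> first_return \<epsilon> k = {}"
      using later[of j k] later[of k j] Int_commute[of "first_return \<epsilon> j" "first_return \<epsilon> k"]
      unfolding nat_neq_iff by argo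
  qed
  have "(\<Sum>k<n. \<rho> \<epsilon> k) * mass \<epsilon> = (\<Sum>k<n. measure \<mu>0 (first_return \<epsilon> k))"
    by (simp only: measure_first_return[OF assms] sum_distrib_right)
  also have "\<dots> = measure \<mu>0 (\<Union>k<n. first_return \<epsilon> k)"
    using sets disj by (intro \<mu>0.finite_measure_finite_Union[symmetric]) auto
  also have "\<dots> \<le> 1 * mass \<epsilon>"
    using A_sets[of \<epsilon>] by (subst mult_1, intro \<mu>0.finite_measure_mono) (auto simp: sets_\<mu>0)
  finally show ?thesis
    using A_positive[OF assms] by (simp only: mult_le_cancel_right_pos)
qed

lemma not_e0: "\<forall>\<^sub>F \<epsilon> in at e0. \<epsilon> \<noteq> e0"
  by (simp add: eventually_at_filter)

lemma q_nonneg: "0 \<le> q k"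
  by (rule tendsto_lowerbound[OF q_limit always_eventually not_isolated]) (simp add: \<rho>_nonneg)

lemma q_summable: "summable q"
proof (rule summableI_nonneg_bounded[OF q_nonneg])
  fix n
  have "((\<lambda>\<epsilon>. \<Sum>k<n. \<rho> \<epsilon> k) \<longlongrightarrow> (\<Sum>k<n. q k)) (at e0)"
    by (intro tendsto_sum q_limit)
  then show "(\<Sum>k<n. q k) \<le> 1"
    by (rule tendsto_upperbound[OF _ eventually_mono[OF not_e0] not_isolated]) (rule \<rho>_sum_le_1)
qed

subsection \<open>Asymptotics of the leading eigenvalue\<close>

lemma \<eta>_lim: "(\<eta> \<longlongrightarrow> 0) (at e0)"
  by (rule \<eta>_tendsto_0[OF lasota_yorke])

lemma \<eta>_pos: "\<epsilon> \<noteq> e0 \<Longrightarrow> 0 < \<eta> \<epsilon>"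
  using defect_functional_le[where \<epsilon> = \<epsilon> and f = "\<phi> e0"] A_positive[of \<epsilon>] \<eta>_nonneg[of \<epsilon>]
  by (cases "\<eta> \<epsilon> = 0") (auto simp: defect_\<phi>0)

lemma tendsto_of_\<eta>_bound:
  fixes f :: "'e \<Rightarrow> 'a :: real_normed_vector"
  assumes "\<forall>\<^sub>F \<epsilon> in at e0. norm (f \<epsilon> - a) \<le> C * \<eta> \<epsilon>"
  shows "(f \<longlongrightarrow> a) (at e0)"
  by (rule Lim_transform_bound[where g = "\<lambda>\<epsilon>. C * \<eta> \<epsilon>", THEN LIM_zero_cancel])
    (use assms tendsto_mult_right_zero[OF \<eta>_lim] in \<open>auto elim: eventually_mono\<close>)

lemma lam_lim: "(lam \<longlongrightarrow> 1) (at e0)"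
proof -
  obtain B where "\<And>\<epsilon>. cmod (1 - lam \<epsilon>) \<le> B * \<eta> \<epsilon>"
    using one_minus_lam_bound by blast
  then show ?thesis
    by (intro tendsto_of_\<eta>_bound[of _ _ B] always_eventually) (simp add: norm_minus_commute)
qed

lemma lam_ge_half: "\<forall>\<^sub>F \<epsilon> in at e0. cmod (lam \<epsilon>) \<ge> 1 / 2"
  using order_tendstoD(1)[OF tendsto_norm[OF lam_lim], of "1 / 2"] by (auto elim: eventually_mono)

lemma \<nu>_\<phi>0_lim: "((\<lambda>\<epsilon>. \<nu> \<epsilon> (\<phi> e0)) \<longlongrightarrow> 1) (at e0)"
proof -
  obtain C where C: "\<And>\<epsilon> f. cmod (lam \<epsilon>) \<ge> 1 / 2 \<Longrightarrow> cmod (\<nu>\<^sub>0 f - \<nu> \<epsilon> f) \<le> C * \<eta> \<epsilon> * norm f"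
    using \<nu>0_remainder_bound by blast
  show ?thesis
  proof (rule tendsto_of_\<eta>_bound[where C = "C * norm (\<phi> e0)"])
    show "\<forall>\<^sub>F \<epsilon> in at e0. cmod (\<nu> \<epsilon> (\<phi> e0) - 1) \<le> C * norm (\<phi> e0) * \<eta> \<epsilon>"
      using lam_ge_half
    proof eventually_elim
      case (elim \<epsilon>)
      then show ?case
        using C[of \<epsilon> "\<phi> e0"] by (simp add: \<phi>_normalized norm_minus_commute mult_ac)
    qed
  qed
qed

text \<open>Here the bound on \<open>\<nu>\<^sub>0 (1\<^sub>A f)\<close> times the norm of \<open>1\<^sub>A \<phi>\<^sub>0\<close> enters.  Separately, \<open>\<eta>\<close> and the
  norm of the defect of \<open>\<phi>\<^sub>0\<close> may each be much larger than \<open>\<mu>\<^sub>0 (A)\<close>; their product is not, and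
  it is the product that appears in the error term of the eigenvalue expansion.\<close>

lemma \<eta>_norm_defect_le: "\<exists>K\<ge>0. \<forall>\<epsilon>. \<epsilon> \<noteq> e0 \<longrightarrow> \<eta> \<epsilon> * norm (defect \<epsilon> (\<phi> e0)) \<le> K * mass \<epsilon>"
proof -
  obtain K0 where K0: "\<And>\<epsilon> f. cmod (\<nu>\<^sub>0 (ind_mult \<T> rep (A \<epsilon>) f)) * norm (ind_mult \<T> rep (A \<epsilon>) (\<phi> e0))
      \<le> K0 * norm f * cmod (\<nu>\<^sub>0 (ind_mult \<T> rep (A \<epsilon>) (\<phi> e0)))"
    using ind_mult_bound by blast
  define K where "K = max K0 0"
  have "\<eta> \<epsilon> * norm (defect \<epsilon> (\<phi> e0)) \<le> onorm (P e0) * K * mass \<epsilon>" if \<epsilon>: "\<epsilon> \<noteq> e0" for \<epsilon>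
  proof -
    let ?N = "norm (ind_mult \<T> rep (A \<epsilon>) (\<phi> e0))"
    have loss: "cmod (\<nu>\<^sub>0 (defect \<epsilon> f)) * ?N \<le> K * mass \<epsilon> * norm f" for f
    proof -
      have "K0 * norm f * mass \<epsilon> \<le> K * norm f * mass \<epsilon>"
        by (intro mult_right_mono) (auto simp: K_def)
      then show ?thesis
        using K0[of \<epsilon> f] defect_\<phi>0[OF \<epsilon>]
        by (simp add: defect_functional_ind_mult[OF \<epsilon>] mult_ac)
    qed
    have "\<eta> \<epsilon> * ?N \<le> K * mass \<epsilon>"
    proof (cases "?N = 0")
      case True
      then show ?thesis by (simp add: K_def del: norm_eq_zero)
    next
      case False
      then have N: "?N > 0" by simp
      have "\<eta> \<epsilon> \<le> K * mass \<epsilon> / ?N"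
        unfolding eta_def
      proof (rule onorm_bound)
        show "0 \<le> K * mass \<epsilon> / ?N" by (simp add: K_def)
        show "cmod (\<nu>\<^sub>0 (defect \<epsilon> f)) \<le> K * mass \<epsilon> / ?N * norm f" for f
          using loss[of f] N by (simp add: pos_le_divide_eq)
      qed
      then show ?thesis
        using N by (simp add: pos_le_divide_eq)
    qed
    moreover have "norm (defect \<epsilon> (\<phi> e0)) \<le> onorm (P e0) * ?N"
      unfolding defect_eq[OF \<epsilon>] by (rule onorm[OF P_linear])
    ultimately have "\<eta> \<epsilon> * norm (defect \<epsilon> (\<phi> e0)) \<le> \<eta> \<epsilon> * (onorm (P e0) * ?N)"
      and "onorm (P e0) * (\<eta> \<epsilon> * ?N) \<le> onorm (P e0) * (K * mass \<epsilon>)"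
      by (auto intro!: mult_left_mono \<eta>_nonneg onorm_pos_le[OF P_linear])
    then show ?thesis
      by (simp add: mult_ac)
  qed
  moreover have "0 \<le> onorm (P e0) * K"
    using onorm_pos_le[OF P_linear] by (simp add: K_def)
  ultimately show ?thesis by blast
qed

abbreviation escape_ratio :: "'e \<Rightarrow> complex" where
  "escape_ratio \<epsilon> \<equiv> (1 - lam \<epsilon>) / complex_of_real (mass \<epsilon>)"

text \<open>The eigenvalue expansion divided by \<open>\<mu>\<^sub>0 (A)\<close>.  In the error term with \<open>Q\<^sup>n \<phi>\<^sub>0\<close> a factor \<open>\<kappa>\<^sub>n\<close> is
  gained, and what multiplies it is of the order of \<open>\<mu>\<^sub>0 (A)\<close> or of \<open>\<eta> (1 - \<lambda>)\<close>.\<close>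

lemma escape_ratio_expansion:
  "\<exists>K\<ge>0. \<forall>\<epsilon> n. \<epsilon> \<noteq> e0 \<and> cmod (lam \<epsilon>) \<ge> 1 / 2 \<and> n > 0 \<longrightarrow>
     cmod (\<nu> \<epsilon> (\<phi> e0) * escape_ratio \<epsilon> - complex_of_real (1 - (\<Sum>k<n. \<rho> \<epsilon> k)))
     \<le> cmod (inverse (lam \<epsilon>) ^ n - 1)
       + 2 * kappa Q n * (\<eta> \<epsilon> * norm (\<phi> e0) * cmod (escape_ratio \<epsilon>) + K)"
proof -
  obtain K where K: "K \<ge> 0" "\<And>\<epsilon>. \<epsilon> \<noteq> e0 \<Longrightarrow> \<eta> \<epsilon> * norm (defect \<epsilon> (\<phi> e0)) \<le> K * mass \<epsilon>"
    using \<eta>_norm_defect_le by blast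
  have "cmod (\<nu> \<epsilon> (\<phi> e0) * escape_ratio \<epsilon> - complex_of_real (1 - (\<Sum>k<n. \<rho> \<epsilon> k)))
     \<le> cmod (inverse (lam \<epsilon>) ^ n - 1)
       + 2 * kappa Q n * (\<eta> \<epsilon> * norm (\<phi> e0) * cmod (escape_ratio \<epsilon>) + K)"
    if \<epsilon>: "\<epsilon> \<noteq> e0" and lam: "cmod (lam \<epsilon>) \<ge> 1 / 2" and n: "n > 0" for \<epsilon> n
  proof -
    have m: "mass \<epsilon> > 0"
      by (rule A_positive[OF \<epsilon>])
    define x where "x = (inverse (lam \<epsilon>) ^ n - 1) * \<nu>\<^sub>0 (defect \<epsilon> ((P \<epsilon> ^^ n) (\<phi> e0)))"
    define y where "y = \<nu>\<^sub>0 (defect \<epsilon> ((Q \<epsilon> ^^ n) (\<phi> e0)))"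
    have "\<nu> \<epsilon> (\<phi> e0) * (1 - lam \<epsilon>)
        = complex_of_real (mass \<epsilon>) * complex_of_real (1 - (\<Sum>k<n. \<rho> \<epsilon> k)) + x - y"
      unfolding eigenvalue_expansion[OF n] defect_\<phi>0[OF \<epsilon>] defect_P_pow_defect_\<phi>0[OF \<epsilon>]
        x_def y_def
      by (simp add: algebra_simps sum_distrib_left)
    then have "\<nu> \<epsilon> (\<phi> e0) * escape_ratio \<epsilon> - complex_of_real (1 - (\<Sum>k<n. \<rho> \<epsilon> k))
        = (x - y) / complex_of_real (mass \<epsilon>)"
      using m by (simp add: field_simps)
    then have "cmod (\<nu> \<epsilon> (\<phi> e0) * escape_ratio \<epsilon> - complex_of_real (1 - (\<Sum>k<n. \<rho> \<epsilon> k)))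
        \<le> (cmod x + cmod y) / mass \<epsilon>"
      using m norm_triangle_ineq4[of x y] by (simp add: norm_divide divide_right_mono)
    also have "\<dots> \<le> cmod (inverse (lam \<epsilon>) ^ n - 1)
        + 2 * kappa Q n * (\<eta> \<epsilon> * norm (\<phi> e0) * cmod (escape_ratio \<epsilon>) + K)"
    proof -
      have x: "cmod x \<le> cmod (inverse (lam \<epsilon>) ^ n - 1) * mass \<epsilon>"
        unfolding x_def norm_mult by (intro mult_left_mono defect_P_pow_\<phi>0_le[OF \<epsilon>]) simp
      have one_minus: "cmod (1 - lam \<epsilon>) = cmod (escape_ratio \<epsilon>) * mass \<epsilon>"
        using m by (simp add: norm_divide)
      obtain p where p: "n = Suc p"
        using n by (cases n) auto
      have "cmod y \<le> \<eta> \<epsilon> * norm ((Q \<epsilon> ^^ n) (\<phi> e0))"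
        unfolding y_def by (rule defect_functional_le)
      also have "\<dots> \<le> \<eta> \<epsilon> * (kappa Q n
          * (2 * (cmod (1 - lam \<epsilon>) * norm (\<phi> e0) + norm (defect \<epsilon> (\<phi> e0)))))"
        unfolding p
        by (intro mult_left_mono \<eta>_nonneg order_trans[OF norm_Q_pow_le_kappa] kappa_nonneg
            norm_\<phi>0_diff_normalized_le lam)
      also have "\<dots> = 2 * kappa Q n * (\<eta> \<epsilon> * norm (\<phi> e0) * cmod (1 - lam \<epsilon>)
          + \<eta> \<epsilon> * norm (defect \<epsilon> (\<phi> e0)))"
        by (simp add: algebra_simps)
      also have "\<dots> \<le> 2 * kappa Q n * (\<eta> \<epsilon> * norm (\<phi> e0) * cmod (1 - lam \<epsilon>) + K * mass \<epsilon>)"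
        using K(2)[OF \<epsilon>] kappa_nonneg by (intro mult_left_mono add_left_mono) auto
      also have "\<dots> = 2 * kappa Q n * (\<eta> \<epsilon> * norm (\<phi> e0) * cmod (escape_ratio \<epsilon>) + K) * mass \<epsilon>"
        unfolding one_minus by (simp add: algebra_simps)
      finally show ?thesis
        using x m by (simp add: pos_divide_le_eq distrib_right)
    qed
    finally show ?thesis .
  qed
  with K(1) show ?thesis by blast
qed

text \<open>For fixed \<open>n\<close> the expansion determines the escape ratio up to \<open>\<kappa>\<^sub>n\<close> as the hole shrinks.
  The error also contains the ratio itself, so that the ratio has first to be shown to be
  bounded; the case \<open>n = 1\<close> does this.\<close>

lemma escape_ratio_bounded: "\<exists>R. \<forall>\<^sub>F \<epsilon> in at e0. cmod (escape_ratio \<epsilon>) \<le> R"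
proof -
  obtain K where K: "K \<ge> 0" "\<And>\<epsilon> n. \<epsilon> \<noteq> e0 \<Longrightarrow> cmod (lam \<epsilon>) \<ge> 1 / 2 \<Longrightarrow> n > 0 \<Longrightarrow>
     cmod (\<nu> \<epsilon> (\<phi> e0) * escape_ratio \<epsilon> - complex_of_real (1 - (\<Sum>k<n. \<rho> \<epsilon> k)))
     \<le> cmod (inverse (lam \<epsilon>) ^ n - 1)
       + 2 * kappa Q n * (\<eta> \<epsilon> * norm (\<phi> e0) * cmod (escape_ratio \<epsilon>) + K)"
    using escape_ratio_expansion by blast
  let ?c = "2 * kappa Q 1 * norm (\<phi> e0)"
  have "((\<lambda>\<epsilon>. ?c * \<eta> \<epsilon>) \<longlongrightarrow> 0) (at e0)"
    by (rule tendsto_mult_right_zero[OF \<eta>_lim])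
  then have "\<forall>\<^sub>F \<epsilon> in at e0. ?c * \<eta> \<epsilon> < 1 / 4"
    by (rule order_tendstoD) simp
  moreover have "\<forall>\<^sub>F \<epsilon> in at e0. cmod (\<nu> \<epsilon> (\<phi> e0)) > 1 / 2"
    using order_tendstoD(1)[OF tendsto_norm[OF \<nu>_\<phi>0_lim], of "1 / 2"] by simp
  ultimately have "\<forall>\<^sub>F \<epsilon> in at e0. cmod (escape_ratio \<epsilon>) \<le> 4 * (1 + 3 + 2 * kappa Q 1 * K)"
    using lam_ge_half not_e0
  proof eventually_elim
    case (elim \<epsilon>)
    define r where "r = cmod (escape_ratio \<epsilon>)"
    define v where "v = cmod (\<nu> \<epsilon> (\<phi> e0) * escape_ratio \<epsilon> - complex_of_real (1 - \<rho> \<epsilon> 0))"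
    have "cmod (inverse (lam \<epsilon>) - 1) \<le> inverse (cmod (lam \<epsilon>)) + 1"
      using norm_triangle_ineq4[of "inverse (lam \<epsilon>)" 1] by (simp add: norm_inverse)
    with inverse_lam_le[OF elim(3)] have inv: "cmod (inverse (lam \<epsilon>) - 1) \<le> 3"
      by simp
    have "1 / 2 * r \<le> cmod (\<nu> \<epsilon> (\<phi> e0) * escape_ratio \<epsilon>)"
      unfolding norm_mult r_def using elim(2) by (intro mult_right_mono) auto
    also have "\<dots> \<le> \<bar>1 - \<rho> \<epsilon> 0\<bar> + v"
      unfolding v_def norm_of_real[symmetric, where 'a = complex] by (rule norm_triangle_sub)
    also have "\<bar>1 - \<rho> \<epsilon> 0\<bar> \<le> 1"
      using \<rho>_nonneg[of \<epsilon> 0] \<rho>_sum_le_1[OF elim(4), of 1] by simp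
    also have "v \<le> 3 + (?c * \<eta> \<epsilon> * r + 2 * kappa Q 1 * K)"
    proof -
      have "v \<le> cmod (inverse (lam \<epsilon>) - 1) + 2 * kappa Q 1 * (\<eta> \<epsilon> * norm (\<phi> e0) * r + K)"
        using K(2)[OF elim(4,3), of 1] by (simp add: v_def r_def)
      also have "2 * kappa Q 1 * (\<eta> \<epsilon> * norm (\<phi> e0) * r + K) = ?c * \<eta> \<epsilon> * r + 2 * kappa Q 1 * K"
        by (simp add: algebra_simps)
      finally show ?thesis
        using inv by linarith
    qed
    also have "?c * \<eta> \<epsilon> * r \<le> 1 / 4 * r"
      using elim(1) by (intro mult_right_mono) (auto simp: r_def)
    finally have "1 / 2 * r \<le> 1 + (3 + (1 / 4 * r + 2 * kappa Q 1 * K))"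
      by simp
    then show ?case
      unfolding r_def[symmetric] by simp
  qed
  then show ?thesis by blast
qed

lemma escape_ratio_lim: "(escape_ratio \<longlongrightarrow> complex_of_real (1 - suminf q)) (at e0)"
proof (rule tendstoI)
  fix e :: real
  assume e: "e > 0"
  obtain K where K: "K \<ge> 0" "\<And>\<epsilon> n. \<epsilon> \<noteq> e0 \<Longrightarrow> cmod (lam \<epsilon>) \<ge> 1 / 2 \<Longrightarrow> n > 0 \<Longrightarrow>
     cmod (\<nu> \<epsilon> (\<phi> e0) * escape_ratio \<epsilon> - complex_of_real (1 - (\<Sum>k<n. \<rho> \<epsilon> k)))
     \<le> cmod (inverse (lam \<epsilon>) ^ n - 1)
       + 2 * kappa Q n * (\<eta> \<epsilon> * norm (\<phi> e0) * cmod (escape_ratio \<epsilon>) + K)"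
    using escape_ratio_expansion by blast
  obtain R where R: "\<forall>\<^sub>F \<epsilon> in at e0. cmod (escape_ratio \<epsilon>) \<le> R"
    using escape_ratio_bounded by blast
  have "(\<lambda>n. 2 * kappa Q n * K + \<bar>(\<Sum>k<n. q k) - suminf q\<bar>) \<longlonglongrightarrow> 2 * 0 * K + \<bar>suminf q - suminf q\<bar>"
    by (intro tendsto_intros kappa_tendsto_0 summable_LIMSEQ q_summable)
  then have "\<forall>\<^sub>F n in sequentially. 2 * kappa Q n * K + \<bar>(\<Sum>k<n. q k) - suminf q\<bar> < e / 2"
    by (rule order_tendstoD) (use e in simp)
  from eventually_conj[OF this eventually_gt_at_top[of 0]]
  obtain n where n: "2 * kappa Q n * K + \<bar>(\<Sum>k<n. q k) - suminf q\<bar> < e / 2" "n > 0"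
    by (auto simp: eventually_sequentially)
  \<comment> \<open>the part of the error that vanishes for this fixed \<open>n\<close> as the hole shrinks\<close>
  define G where "G \<epsilon> = cmod (inverse (lam \<epsilon>) ^ n - 1) + 2 * kappa Q n * (\<eta> \<epsilon> * norm (\<phi> e0) * R)
    + cmod (\<nu> \<epsilon> (\<phi> e0) - 1) * R + \<bar>(\<Sum>k<n. \<rho> \<epsilon> k) - (\<Sum>k<n. q k)\<bar>" for \<epsilon>
  have "(G \<longlongrightarrow> cmod (inverse 1 ^ n - 1) + 2 * kappa Q n * (0 * norm (\<phi> e0) * R)
    + cmod (1 - 1) * R + \<bar>(\<Sum>k<n. q k) - (\<Sum>k<n. q k)\<bar>) (at e0)"
    unfolding G_def by (intro tendsto_intros lam_lim \<eta>_lim \<nu>_\<phi>0_lim q_limit) simp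
  then have "(G \<longlongrightarrow> 0) (at e0)"
    by simp
  then have "\<forall>\<^sub>F \<epsilon> in at e0. G \<epsilon> < e / 2"
    by (rule order_tendstoD) (use e in simp)
  then show "\<forall>\<^sub>F \<epsilon> in at e0. dist (escape_ratio \<epsilon>) (complex_of_real (1 - suminf q)) < e"
    using R lam_ge_half not_e0
  proof eventually_elim
    case (elim \<epsilon>)
    let ?\<nu> = "\<nu> \<epsilon> (\<phi> e0)"
    define r where "r = escape_ratio \<epsilon>"
    define a where "a = ?\<nu> * r - complex_of_real (1 - (\<Sum>k<n. \<rho> \<epsilon> k))"
    define b where "b = (?\<nu> - 1) * r"
    define c where "c = (\<Sum>k<n. \<rho> \<epsilon> k) - (\<Sum>k<n. q k)"
    define d where "d = (\<Sum>k<n. q k) - suminf q"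
    have "dist r (complex_of_real (1 - suminf q)) = cmod (a - b - complex_of_real (c + d))"
      by (simp add: dist_norm a_def b_def c_def d_def algebra_simps)
    also have "\<dots> \<le> cmod a + cmod b + (\<bar>c\<bar> + \<bar>d\<bar>)"
      using norm_triangle_ineq4[of "a - b" "complex_of_real (c + d)"] norm_triangle_ineq4[of a b]
      unfolding norm_of_real by linarith
    also have "\<dots> \<le> G \<epsilon> + (2 * kappa Q n * K + \<bar>d\<bar>)"
    proof -
      have "cmod b \<le> cmod (?\<nu> - 1) * R"
        unfolding b_def norm_mult r_def using elim by (intro mult_left_mono) auto
      moreover have "2 * kappa Q n * (\<eta> \<epsilon> * norm (\<phi> e0) * cmod r + K)
          \<le> 2 * kappa Q n * (\<eta> \<epsilon> * norm (\<phi> e0) * R + K)"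
        unfolding r_def using elim kappa_nonneg \<eta>_nonneg
        by (intro mult_left_mono add_right_mono) auto
      ultimately show ?thesis
        using K(2)[OF elim(4,3) n(2)]
        unfolding G_def r_def[symmetric] a_def[symmetric] c_def[symmetric]
        by (simp add: algebra_simps)
    qed
    also have "\<dots> < e"
      using n(1) elim(1) unfolding d_def[symmetric] by linarith
    finally show ?case
      unfolding r_def .
  qed
qed

subsection \<open>Hitting times\<close>

lemma survival_expansion:
  assumes "\<epsilon> \<noteq> e0"
  shows "complex_of_real (measure \<mu>0 {x. \<forall>i<Suc n. (T ^^ i) x \<notin> A \<epsilon>})
    = lam \<epsilon> ^ Suc n * (\<nu> \<epsilon> (\<phi> e0) + \<nu>\<^sub>0 ((Q \<epsilon> ^^ Suc n) (\<phi> e0)))"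
  unfolding survival_measure[OF assms, symmetric] P_pow_decomp \<nu>0_scaleC
    bounded_linear_plus[OF \<nu>0_linear]
  by (simp add: \<phi>_normalized del: funpow.simps)

text \<open>The eigenvalue is the limit of the conditional survival probabilities, hence a nonnegative
  real number.\<close>

lemma lam_pos_real:
  assumes \<epsilon>: "\<epsilon> \<noteq> e0" and nz: "\<nu> \<epsilon> (\<phi> e0) \<noteq> 0"
  shows "Re (lam \<epsilon>) > 0 \<and> lam \<epsilon> = complex_of_real (Re (lam \<epsilon>))"
proof -
  define a where "a n = measure \<mu>0 {x. \<forall>i<Suc n. (T ^^ i) x \<notin> A \<epsilon>}" for n
  define c where "c n = \<nu> \<epsilon> (\<phi> e0) + \<nu>\<^sub>0 ((Q \<epsilon> ^^ Suc n) (\<phi> e0))" for n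
  have a: "complex_of_real (a n) = lam \<epsilon> ^ Suc n * c n" for n
    unfolding a_def c_def by (rule survival_expansion[OF \<epsilon>])
  have "(\<lambda>n. \<nu>\<^sub>0 ((Q \<epsilon> ^^ Suc n) (\<phi> e0))) \<longlonglongrightarrow> 0"
    using bounded_linear.tendsto[OF \<nu>0_linear Q_pow_tendsto_0[where \<epsilon> = \<epsilon> and f = "\<phi> e0"],
        THEN LIMSEQ_Suc]
    by (simp add: bounded_linear_0[OF \<nu>0_linear] del: funpow.simps)
  from tendsto_add[OF tendsto_const this] have c: "c \<longlonglongrightarrow> \<nu> \<epsilon> (\<phi> e0)"
    by (simp add: c_def[abs_def] del: funpow.simps)
  have "(\<lambda>n. lam \<epsilon> * (c (Suc n) / c n)) \<longlonglongrightarrow> lam \<epsilon> * (\<nu> \<epsilon> (\<phi> e0) / \<nu> \<epsilon> (\<phi> e0))"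
    by (intro tendsto_intros c LIMSEQ_Suc nz)
  moreover have "lam \<epsilon> * (c (Suc n) / c n) = complex_of_real (a (Suc n) / a n)" for n
    unfolding of_real_divide a using lam_nonzero[of \<epsilon>] by simp
  ultimately have lim: "(\<lambda>n. complex_of_real (a (Suc n) / a n)) \<longlonglongrightarrow> lam \<epsilon>"
    using nz by simp
  have "Re (lam \<epsilon>) \<ge> 0"
    by (rule LIMSEQ_le_const[OF tendsto_Re[OF lim]]) (simp add: a_def)
  moreover have "Im (lam \<epsilon>) = 0"
    using LIMSEQ_unique[OF tendsto_Im[OF lim]] by simp
  ultimately show ?thesis
    using lam_nonzero[of \<epsilon>] by (auto simp: complex_eq_iff less_le)
qed

text \<open>With this normalisation the real power of \<open>\<lambda>\<close> with exponent \<open>t / (\<xi> \<mu>\<^sub>0 (A))\<close> is exactly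
  \<open>e\<^sup>-\<^sup>t\<close>.\<close>

definition \<xi> :: "'e \<Rightarrow> real" where
  "\<xi> \<epsilon> = - ln (Re (lam \<epsilon>)) / mass \<epsilon>"

lemma \<nu>_\<phi>0_nonzero: "\<forall>\<^sub>F \<epsilon> in at e0. \<nu> \<epsilon> (\<phi> e0) \<noteq> 0"
  by (rule tendsto_imp_eventually_ne[OF \<nu>_\<phi>0_lim]) simp

text \<open>Strictly below \<open>1\<close> because the limit \<open>1 - suminf q\<close> of the escape ratio is positive.\<close>

lemma lam_between:
  assumes "suminf q < 1"
  shows "\<forall>\<^sub>F \<epsilon> in at e0. 0 < Re (lam \<epsilon>) \<and> Re (lam \<epsilon>) < 1 \<and> lam \<epsilon> = complex_of_real (Re (lam \<epsilon>))"
proof -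
  have "((\<lambda>\<epsilon>. Re (escape_ratio \<epsilon>)) \<longlongrightarrow> 1 - suminf q) (at e0)"
    using tendsto_Re[OF escape_ratio_lim] by simp
  then have "\<forall>\<^sub>F \<epsilon> in at e0. Re (escape_ratio \<epsilon>) > 0"
    by (rule order_tendstoD) (use assms in simp)
  then show ?thesis
    using \<nu>_\<phi>0_nonzero not_e0
  proof eventually_elim
    case (elim \<epsilon>)
    have "Re (escape_ratio \<epsilon>) = (1 - Re (lam \<epsilon>)) / mass \<epsilon>"
      by simp
    with elim(1) A_positive[OF elim(3)] have "Re (lam \<epsilon>) < 1"
      by (simp add: zero_less_divide_iff)
    with lam_pos_real[OF elim(3,2)] show ?case by simp
  qed
qed

text \<open>The logarithm is squeezed by \<open>1 - l \<le> - ln l \<le> (1 - l) / l\<close>.\<close>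

lemma \<xi>_lim:
  assumes "suminf q < 1"
  shows "(\<xi> \<longlongrightarrow> 1 - suminf q) (at e0)"
proof (rule tendsto_sandwich)
  let ?r = "\<lambda>\<epsilon>. Re (escape_ratio \<epsilon>)"
  show r: "(?r \<longlongrightarrow> 1 - suminf q) (at e0)"
    using tendsto_Re[OF escape_ratio_lim] by simp
  have "((\<lambda>\<epsilon>. ?r \<epsilon> / Re (lam \<epsilon>)) \<longlongrightarrow> (1 - suminf q) / Re 1) (at e0)"
    by (intro tendsto_divide r tendsto_Re lam_lim) simp
  then show "((\<lambda>\<epsilon>. ?r \<epsilon> / Re (lam \<epsilon>)) \<longlongrightarrow> 1 - suminf q) (at e0)"
    by simp
  show "\<forall>\<^sub>F \<epsilon> in at e0. ?r \<epsilon> \<le> \<xi> \<epsilon>"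
    using lam_between[OF assms] not_e0
  proof eventually_elim
    case (elim \<epsilon>)
    then have "1 - Re (lam \<epsilon>) \<le> - ln (Re (lam \<epsilon>))"
      using ln_le_minus_one[of "Re (lam \<epsilon>)"] by simp
    then have "(1 - Re (lam \<epsilon>)) / mass \<epsilon> \<le> - ln (Re (lam \<epsilon>)) / mass \<epsilon>"
      by (rule divide_right_mono) simp
    then show ?case
      by (simp add: \<xi>_def)
  qed
  show "\<forall>\<^sub>F \<epsilon> in at e0. \<xi> \<epsilon> \<le> ?r \<epsilon> / Re (lam \<epsilon>)"
    using lam_between[OF assms] not_e0
  proof eventually_elim
    case (elim \<epsilon>)
    define l where "l = Re (lam \<epsilon>)"
    have l: "0 < l"
      using elim by (simp add: l_def)
    then have "- ln l \<le> inverse l - 1"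
      using ln_le_minus_one[of "inverse l"] by (simp add: ln_inverse)
    also have "\<dots> = (1 - l) / l"
      using l by (simp add: field_simps)
    finally have "- ln l / mass \<epsilon> \<le> (1 - l) / l / mass \<epsilon>"
      using A_positive[OF elim(2)] by (intro divide_right_mono) auto
    then show ?case
      by (simp add: \<xi>_def l_def mult.commute)
  qed
qed

text \<open>Rounding the time up to an integer changes \<open>e\<^sup>-\<^sup>t\<close> by at most the factor \<open>\<lambda> \<ge> 1 - B \<eta>\<close>, and
  the survival probability differs from \<open>\<lambda>\<^sup>n\<close> by a factor \<open>1 + O(\<eta>)\<close>, where it matters that the
  rounded time is positive, since the decomposition of \<open>P\<^sup>n\<close> starts at \<open>n = 1\<close>.\<close>

lemma hitting_time_bound:
  assumes "suminf q < 1"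
  shows "\<exists>C>0. \<forall>\<^sub>F \<epsilon> in at e0. \<xi> \<epsilon> > 0 \<and>
    (\<forall>t>0. \<bar>measure \<mu>0 {x. ereal_of_enat (hitting_time T (A \<epsilon>) x) \<ge> ereal (t / (\<xi> \<epsilon> * mass \<epsilon>))}
        - exp (- t)\<bar> \<le> C * \<eta> \<epsilon> * exp (- t))"
proof -
  obtain B where B: "0 \<le> B" "\<And>\<epsilon>. cmod (1 - lam \<epsilon>) \<le> B * \<eta> \<epsilon>"
    using one_minus_lam_bound by blast
  obtain C where C: "0 \<le> C"
      "\<And>\<epsilon> n f. cmod (lam \<epsilon>) \<ge> 1 / 2 \<Longrightarrow> cmod (\<nu>\<^sub>0 ((Q \<epsilon> ^^ Suc n) f)) \<le> C * \<eta> \<epsilon> * norm f"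
      "\<And>\<epsilon> f. cmod (lam \<epsilon>) \<ge> 1 / 2 \<Longrightarrow> cmod (\<nu>\<^sub>0 f - \<nu> \<epsilon> f) \<le> C * \<eta> \<epsilon> * norm f"
    using \<nu>0_remainder_bound by blast
  \<comment> \<open>the summand \<open>1\<close> only makes the constant positive\<close>
  define C' where "C' = 2 * C * norm (\<phi> e0) + B + 1"
  have "\<forall>\<^sub>F \<epsilon> in at e0. \<xi> \<epsilon> > 0 \<and>
    (\<forall>t>0. \<bar>measure \<mu>0 {x. ereal_of_enat (hitting_time T (A \<epsilon>) x) \<ge> ereal (t / (\<xi> \<epsilon> * mass \<epsilon>))}
        - exp (- t)\<bar> \<le> C' * \<eta> \<epsilon> * exp (- t))"
    using lam_between[OF assms] lam_ge_half not_e0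
  proof eventually_elim
    case (elim \<epsilon>)
    define l where "l = Re (lam \<epsilon>)"
    define h where "h = - ln l"
    have l: "0 < l" "l < 1" and lam: "lam \<epsilon> = complex_of_real l"
      using elim(1) by (auto simp: l_def)
    have h: "h > 0" and l_exp: "l = exp (- h)"
      using l by (simp_all add: h_def)
    have m: "mass \<epsilon> > 0"
      by (rule A_positive[OF elim(3)])
    have "\<xi> \<epsilon> = h / mass \<epsilon>"
      by (simp add: \<xi>_def h_def l_def)
    then have \<xi>: "\<xi> \<epsilon> * mass \<epsilon> = h" "\<xi> \<epsilon> > 0"
      using m h by simp_all
    have "\<bar>measure \<mu>0 {x. ereal_of_enat (hitting_time T (A \<epsilon>) x) \<ge> ereal (t / (\<xi> \<epsilon> * mass \<epsilon>))}
        - exp (- t)\<bar> \<le> C' * \<eta> \<epsilon> * exp (- t)" if t: "t > 0" for t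
    proof -
      define n where "n = nat \<lceil>t / h\<rceil>"
      have "0 < t / h"
        using t h by simp
      then have n: "t / h \<le> real n" "real n \<le> t / h + 1"
        unfolding n_def by linarith+
      with \<open>0 < t / h\<close> obtain p where p: "n = Suc p"
        by (cases n) auto
      have hn: "t \<le> h * real n" "h * real n \<le> t + h"
        using n h by (auto simp: field_simps)
      define z where "z = \<nu> \<epsilon> (\<phi> e0) + \<nu>\<^sub>0 ((Q \<epsilon> ^^ n) (\<phi> e0))"
      have "complex_of_real (measure \<mu>0 {x. \<forall>i<n. (T ^^ i) x \<notin> A \<epsilon>}) = complex_of_real (l ^ n) * z"
        unfolding z_def p survival_expansion[OF elim(3)] lam by simp
      from arg_cong[OF this, of Re] have "measure \<mu>0 {x. \<forall>i<n. (T ^^ i) x \<notin> A \<epsilon>} = l ^ n * Re z"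
        by (simp del: of_real_power)
      then have meas: "measure \<mu>0 {x. ereal_of_enat (hitting_time T (A \<epsilon>) x)
          \<ge> ereal (t / (\<xi> \<epsilon> * mass \<epsilon>))} = l ^ n * Re z"
        unfolding ereal_le_hitting_time_iff \<xi>(1) n_def .
      have "\<bar>Re z - 1\<bar> \<le> cmod (z - 1)"
        using abs_Re_le_cmod[of "z - 1"] by simp
      also have "z - 1 = \<nu>\<^sub>0 ((Q \<epsilon> ^^ n) (\<phi> e0)) - (\<nu>\<^sub>0 (\<phi> e0) - \<nu> \<epsilon> (\<phi> e0))"
        by (simp add: z_def \<phi>_normalized)
      also have "cmod \<dots> \<le> C * \<eta> \<epsilon> * norm (\<phi> e0) + C * \<eta> \<epsilon> * norm (\<phi> e0)"
        unfolding p by (rule order_trans[OF norm_triangle_ineq4 add_mono]) (rule C elim(2))+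
      finally have z: "\<bar>Re z - 1\<bar> \<le> 2 * C * norm (\<phi> e0) * \<eta> \<epsilon>"
        by (simp add: algebra_simps)
      have ln: "l ^ n = exp (- (h * real n))"
        unfolding l_exp by (simp add: exp_of_nat_mult[symmetric] mult.commute)
      have upper: "l ^ n \<le> exp (- t)"
        unfolding ln using hn by simp
      have lower: "l * exp (- t) \<le> l ^ n"
        unfolding ln unfolding l_exp exp_add[symmetric] using hn by simp
      have "1 - l \<le> B * \<eta> \<epsilon>"
        using B(2)[of \<epsilon>] complex_Re_le_cmod[of "1 - lam \<epsilon>"] by (simp add: l_def)
      then have "(1 - l) * exp (- t) \<le> B * \<eta> \<epsilon> * exp (- t)"
        by (rule mult_right_mono) simp
      then have diff: "\<bar>l ^ n - exp (- t)\<bar> \<le> B * \<eta> \<epsilon> * exp (- t)"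
        using upper lower by (simp add: abs_le_iff algebra_simps)
      have "l ^ n * \<bar>Re z - 1\<bar> \<le> exp (- t) * (2 * C * norm (\<phi> e0) * \<eta> \<epsilon>)"
        using upper z by (intro mult_mono) auto
      moreover have "l ^ n * Re z - exp (- t) = l ^ n * (Re z - 1) + (l ^ n - exp (- t))"
        by (simp add: algebra_simps)
      moreover have "\<bar>l ^ n * (Re z - 1)\<bar> = l ^ n * \<bar>Re z - 1\<bar>"
        using l by (simp add: abs_mult)
      moreover have "0 \<le> \<eta> \<epsilon> * exp (- t)"
        using \<eta>_nonneg by simp
      ultimately have "\<bar>l ^ n * Re z - exp (- t)\<bar>
          \<le> exp (- t) * (2 * C * norm (\<phi> e0) * \<eta> \<epsilon>) + B * \<eta> \<epsilon> * exp (- t) + \<eta> \<epsilon> * exp (- t)"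
        using diff by linarith
      then show ?thesis
        unfolding meas C'_def by (simp add: algebra_simps)
    qed
    with \<xi>(2) show ?case by blast
  qed
  moreover have "C' > 0"
    using B(1) C(1) by (simp add: C'_def add_nonneg_pos)
  ultimately show ?thesis by blast
qed

end

theorem proposition2:
  fixes T :: "'m::metric_space \<Rightarrow> 'm"
    and N0 \<mu>0 :: "'m measure"
    and \<T> :: "('m \<Rightarrow> complex) set"
    and rep :: "'v::complex_banach \<Rightarrow> 'm gfun"
    and e0 :: "'e::topological_space"
    and A :: "'e \<Rightarrow> 'm set"
    and P Q :: "'e \<Rightarrow> 'v \<Rightarrow> 'v"
    and lam :: "'e \<Rightarrow> complex"
    and \<phi> :: "'e \<Rightarrow> 'v"
    and \<nu> :: "'e \<Rightarrow> 'v \<Rightarrow> complex"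
    and q :: "nat \<Rightarrow> real"
    and \<theta> :: real
  assumes setting: "repfo T N0 \<T> rep e0 A P (\<phi> e0) (Q e0)"
    and spectral: "repfo_spectral (ref_functional N0 rep) e0 P lam \<phi> \<nu> Q"
    and mu0: "invariant_measure_of T N0 \<T> (rep (\<phi> e0)) \<mu>0"
    and A_positive: "\<And>\<epsilon>. \<epsilon> \<noteq> e0 \<Longrightarrow> measure \<mu>0 (A \<epsilon>) > 0"
    and q_limit: "\<And>k. ((\<lambda>\<epsilon>. return_ratio \<mu>0 T (A \<epsilon>) k) \<longlongrightarrow> q k) (at e0)"
    and theta: "\<theta> = 1 - (\<Sum>k. q k)"
    and theta_positive: "\<theta> > 0"
  shows "delta (ref_functional N0 rep) e0 P Q
           \<in> O[at e0](\<lambda>\<epsilon>. \<bar>eta (ref_functional N0 rep) e0 P \<epsilon>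
                              * ln (eta (ref_functional N0 rep) e0 P \<epsilon>)\<bar>)
       \<and> (\<exists>C>0. \<exists>\<xi> :: 'e \<Rightarrow> real.
            (\<forall>\<^sub>F \<epsilon> in at e0. \<xi> \<epsilon> > 0 \<and>
               (\<forall>t>0. \<bar>measure \<mu>0 {x. ereal_of_enat (hitting_time T (A \<epsilon>) x)
                                         \<ge> ereal (t / (\<xi> \<epsilon> * measure \<mu>0 (A \<epsilon>)))} - exp (- t)\<bar>
                  \<le> C * delta (ref_functional N0 rep) e0 P Q \<epsilon> * max t 1 * exp (- t)))
          \<and> (\<xi> \<longlongrightarrow> \<theta>) (at e0))"
proof (cases "at e0 = bot")
  \<comment> \<open>at an isolated parameter every asymptotic claim is vacuous\<close>
  case True
  have "delta (ref_functional N0 rep) e0 P Q \<in> O[at e0](\<lambda>\<epsilon>.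
      \<bar>eta (ref_functional N0 rep) e0 P \<epsilon> * ln (eta (ref_functional N0 rep) e0 P \<epsilon>)\<bar>)"
    by (rule bigoI[where c = 1]) (simp add: True)
  then show ?thesis
    by (intro conjI exI[of _ "1 :: real"] exI[of _ "\<lambda>_. 1"]) (simp_all add: True)
next
  case False
  interpret repfo T N0 \<T> rep e0 A P "\<phi> e0" "Q e0"
    by (rule setting)
  interpret repfo_spectral "ref_functional N0 rep" e0 P lam \<phi> \<nu> Q
    by (rule spectral)
  interpret rare_event_limit T N0 \<T> rep e0 A P Q lam \<phi> \<nu> \<mu>0 q
    by unfold_locales (use mu0 A_positive q_limit False in auto)
  have q: "suminf q < 1"
    using theta theta_positive by simp
  have "delta \<nu>\<^sub>0 e0 P Q \<in> O[at e0](\<lambda>\<epsilon>. \<bar>\<eta> \<epsilon> * ln (\<eta> \<epsilon>)\<bar>)"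
    using \<eta>_lim eventually_mono[OF not_e0 \<eta>_pos] by (rule delta_bigo)
  moreover obtain C where C: "C > 0" "\<forall>\<^sub>F \<epsilon> in at e0. \<xi> \<epsilon> > 0 \<and>
      (\<forall>t>0. \<bar>measure \<mu>0 {x. ereal_of_enat (hitting_time T (A \<epsilon>) x) \<ge> ereal (t / (\<xi> \<epsilon> * mass \<epsilon>))}
        - exp (- t)\<bar> \<le> C * \<eta> \<epsilon> * exp (- t))"
    using hitting_time_bound[OF q] by blast
  have weaken: "C * \<eta> \<epsilon> * exp (- t) \<le> C * delta \<nu>\<^sub>0 e0 P Q \<epsilon> * max t 1 * exp (- t)" for \<epsilon> t
  proof -
    have "C * \<eta> \<epsilon> * 1 \<le> C * delta \<nu>\<^sub>0 e0 P Q \<epsilon> * max t 1"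
      using C(1) \<eta>_le_delta[of \<epsilon>] \<eta>_nonneg[of \<epsilon>] by (intro mult_mono) auto
    then show ?thesis
      by (intro mult_right_mono) auto
  qed
  have "\<forall>\<^sub>F \<epsilon> in at e0. \<xi> \<epsilon> > 0 \<and>
      (\<forall>t>0. \<bar>measure \<mu>0 {x. ereal_of_enat (hitting_time T (A \<epsilon>) x) \<ge> ereal (t / (\<xi> \<epsilon> * mass \<epsilon>))}
        - exp (- t)\<bar> \<le> C * delta \<nu>\<^sub>0 e0 P Q \<epsilon> * max t 1 * exp (- t))"
    using C(2) by eventually_elim (meson weaken order_trans)
  moreover have "(\<xi> \<longlongrightarrow> \<theta>) (at e0)"
    unfolding theta by (rule \<xi>_lim[OF q])
  ultimately show ?thesis
    using C(1) by blast
qed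

end
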